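(* If $\mathcal F$ is a Borel filter on $\omega$ and the forcing $\mathbb M(\mathcal F)$ does not add an eventually different real, then $\mathbb M(\mathcal F)$ is forcing equivalent to the Cohen forcing.
   Context: Filters on $\omega$ are proper and contain all cofinite sets; a filter is Borel if it is a Borel subset of $\mathcal P(\omega)\cong 2^\omega$. The Mathias--Prikry forcing $\mathbb M(\mathcal F)$ consists of pairs $(s,A)$ with $s$ a finite subset of $\omega$ and $A\in\mathcal F$, ordered by $(s,A)\le(t,B)$ iff $t\sqsubseteq s$ (i.e. $t=s\cap n$ for some $n\in\omega$), $A\subseteq B$, and $s\setminus t\subseteq B$. A real $r\in\omega^\omega$ in an extension of $V$ is eventually different over $V$ if $\{n : r(n)=f(n)\}$ is finite for each $f\in\omega^\omega\cap V$. A forcing does not add an eventually different real if no generic extension of $V$ by it contains an eventually different real over $V$. Two forcings are equivalent if the complete Boolean algebras of their regular open sets are isomorphic. Cohen forcing is the set of finite subsets of $\omega$ ordered by end-extension. *)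

theory Defs
  imports "HOL-Analysis.Analysis"
begin

text \<open>A forcing notion is given by its set \<open>P\<close> of conditions and its preorder \<open>le\<close>;
  \<open>le q p\<close> says that \<open>q\<close> is stronger than \<open>p\<close>, and only conditions in \<open>P\<close> are ever compared.\<close>

subsection \<open>Forcing equivalence\<close>

definition forcing_topology :: "'p set \<Rightarrow> ('p \<Rightarrow> 'p \<Rightarrow> bool) \<Rightarrow> 'p topology" where
  "forcing_topology P le =
     topology (\<lambda>U. U \<subseteq> P \<and> (\<forall>p\<in>U. \<forall>q\<in>P. le q p \<longrightarrow> q \<in> U))"

lemma istopology_forcing:
  "istopology (\<lambda>U. U \<subseteq> P \<and> (\<forall>p\<in>U. \<forall>q\<in>P. le q p \<longrightarrow> q \<in> U))"
  unfolding istopology_def by blast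

lemma openin_forcing_topology:
  "openin (forcing_topology P le) U \<longleftrightarrow> U \<subseteq> P \<and> (\<forall>p\<in>U. \<forall>q\<in>P. le q p \<longrightarrow> q \<in> U)"
  by (simp add: forcing_topology_def topology_inverse' [OF istopology_forcing])

definition regular_open_sets :: "'p topology \<Rightarrow> 'p set set" where
  "regular_open_sets X = {U. openin X U \<and> X interior_of (X closure_of U) = U}"

text \<open>The complete Boolean algebra structure on the regular open sets. The infimum of the
  empty family is \<open>X interior_of UNIV = topspace X\<close>, the unit of the algebra.\<close>

definition ro_Sup :: "'p topology \<Rightarrow> 'p set set \<Rightarrow> 'p set" where
  "ro_Sup X \<U> = X interior_of (X closure_of (\<Union>\<U>))"

definition ro_Inf :: "'p topology \<Rightarrow> 'p set set \<Rightarrow> 'p set" where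
  "ro_Inf X \<U> = X interior_of (\<Inter>\<U>)"

definition ro_compl :: "'p topology \<Rightarrow> 'p set \<Rightarrow> 'p set" where
  "ro_compl X U = X interior_of (topspace X - U)"

definition ro_isomorphism :: "'p topology \<Rightarrow> 'q topology \<Rightarrow> ('p set \<Rightarrow> 'q set) \<Rightarrow> bool" where
  "ro_isomorphism X Y h \<longleftrightarrow>
     bij_betw h (regular_open_sets X) (regular_open_sets Y) \<and>
     (\<forall>\<U> \<subseteq> regular_open_sets X.
        h (ro_Sup X \<U>) = ro_Sup Y (h ` \<U>) \<and> h (ro_Inf X \<U>) = ro_Inf Y (h ` \<U>)) \<and>
     (\<forall>U \<in> regular_open_sets X. h (ro_compl X U) = ro_compl Y (h U))"

definition forcing_equivalent ::
  "'p set \<Rightarrow> ('p \<Rightarrow> 'p \<Rightarrow> bool) \<Rightarrow> 'q set \<Rightarrow> ('q \<Rightarrow> 'q \<Rightarrow> bool) \<Rightarrow> bool" where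
  "forcing_equivalent P leP Q leQ \<longleftrightarrow>
     (\<exists>h. ro_isomorphism (forcing_topology P leP) (forcing_topology Q leQ) h)"

subsection \<open>The forcing relation and eventually different reals\<close>

text \<open>
  The ground model \<open>V\<close> is the ambient universe, so statements about generic extensions are
  expressed by the forcing relation. A name for a subset of a ground model set of elements of
  type \<open>'a\<close> is a set \<open>\<tau>\<close> of pairs \<open>(a, r)\<close> with \<open>r \<in> P\<close>; its value under a generic filter \<open>G\<close>
  is \<open>{a. \<exists>r\<in>G. (a, r) \<in> \<tau>}\<close>, and every subset of a ground model set in the extension is the
  value of such a name. A statement of the forcing language is represented by the predicate
  \<open>\<phi>\<close> for which \<open>\<phi> p\<close> means that \<open>p\<close> forces it. Conjunction and universal quantification over
  ground model objects are then pointwise, and the other clauses are the usual ones.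
\<close>

definition dense_below :: "'p set \<Rightarrow> ('p \<Rightarrow> 'p \<Rightarrow> bool) \<Rightarrow> 'p \<Rightarrow> 'p set \<Rightarrow> bool" where
  "dense_below P le p D \<longleftrightarrow> (\<forall>q\<in>P. le q p \<longrightarrow> (\<exists>r\<in>P. le r q \<and> r \<in> D))"

definition forces_mem ::
  "'p set \<Rightarrow> ('p \<Rightarrow> 'p \<Rightarrow> bool) \<Rightarrow> 'a \<Rightarrow> ('a \<times> 'p) set \<Rightarrow> 'p \<Rightarrow> bool" where
  "forces_mem P le a \<tau> p \<longleftrightarrow> dense_below P le p {q. \<exists>r. (a, r) \<in> \<tau> \<and> le q r}"

definition forces_not ::
  "'p set \<Rightarrow> ('p \<Rightarrow> 'p \<Rightarrow> bool) \<Rightarrow> ('p \<Rightarrow> bool) \<Rightarrow> 'p \<Rightarrow> bool" where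
  "forces_not P le \<phi> p \<longleftrightarrow> (\<forall>q\<in>P. le q p \<longrightarrow> \<not> \<phi> q)"

definition forces_ex ::
  "'p set \<Rightarrow> ('p \<Rightarrow> 'p \<Rightarrow> bool) \<Rightarrow> ('x \<Rightarrow> 'p \<Rightarrow> bool) \<Rightarrow> 'p \<Rightarrow> bool" where
  "forces_ex P le \<phi> p \<longleftrightarrow> dense_below P le p {q. \<exists>x. \<phi> x q}"

text \<open>The value of \<open>\<tau>\<close> is the graph of a total function on the natural numbers.\<close>

definition forces_real ::
  "'p set \<Rightarrow> ('p \<Rightarrow> 'p \<Rightarrow> bool) \<Rightarrow> ((nat \<times> nat) \<times> 'p) set \<Rightarrow> 'p \<Rightarrow> bool" where
  "forces_real P le \<tau> p \<longleftrightarrow>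
     (\<forall>n. forces_ex P le (\<lambda>m. forces_mem P le (n, m) \<tau>) p) \<and>
     (\<forall>n m m'. m \<noteq> m' \<longrightarrow>
        forces_not P le (\<lambda>q. forces_mem P le (n, m) \<tau> q \<and> forces_mem P le (n, m') \<tau> q) p)"

text \<open>For each \<open>f\<close> in \<open>V\<close>, the set of \<open>n\<close> with \<open>(n, f n)\<close> in the value of \<open>\<tau>\<close> is finite. Finite
  sets of natural numbers are the same in \<open>V\<close> and in the extension, so this says that some
  finite set \<open>S\<close> in \<open>V\<close> contains all such \<open>n\<close>.\<close>

definition forces_eventually_different ::
  "'p set \<Rightarrow> ('p \<Rightarrow> 'p \<Rightarrow> bool) \<Rightarrow> ((nat \<times> nat) \<times> 'p) set \<Rightarrow> 'p \<Rightarrow> bool" where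
  "forces_eventually_different P le \<tau> p \<longleftrightarrow>
     (\<forall>f :: nat \<Rightarrow> nat. forces_ex P le
        (\<lambda>S q. finite S \<and> (\<forall>n. n \<notin> S \<longrightarrow> forces_not P le (forces_mem P le (n, f n) \<tau>) q)) p)"

text \<open>Some generic extension contains an eventually different real over \<open>V\<close> iff some condition
  forces this of some name.\<close>

definition adds_eventually_different_real :: "'p set \<Rightarrow> ('p \<Rightarrow> 'p \<Rightarrow> bool) \<Rightarrow> bool" where
  "adds_eventually_different_real P le \<longleftrightarrow>
     (\<exists>p\<in>P. \<exists>\<tau> \<subseteq> UNIV \<times> P. forces_real P le \<tau> p \<and> forces_eventually_different P le \<tau> p)"

subsection \<open>Mathias--Prikry and Cohen forcing\<close>

definition initial_segment :: "nat set \<Rightarrow> nat set \<Rightarrow> bool" where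
  "initial_segment t s \<longleftrightarrow> (\<exists>n. t = s \<inter> {..<n})"

definition mathias_conditions :: "nat filter \<Rightarrow> (nat set \<times> nat set) set" where
  "mathias_conditions F = {(s, A). finite s \<and> eventually (\<lambda>n. n \<in> A) F}"

definition mathias_le :: "nat set \<times> nat set \<Rightarrow> nat set \<times> nat set \<Rightarrow> bool" where
  "mathias_le = (\<lambda>(s, A) (t, B). initial_segment t s \<and> A \<subseteq> B \<and> s - t \<subseteq> B)"

definition cohen_conditions :: "nat set set" where
  "cohen_conditions = {s. finite s}"

definition cohen_le :: "nat set \<Rightarrow> nat set \<Rightarrow> bool" where
  "cohen_le s t \<longleftrightarrow> initial_segment t s"

text \<open>Subsets of the natural numbers are identified with their characteristic functions;
  \<open>nat \<Rightarrow> bool\<close> carries the product topology of the discrete space \<open>bool\<close>.\<close>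

definition borel_filter :: "nat filter \<Rightarrow> bool" where
  "borel_filter F \<longleftrightarrow> {x. eventually x F} \<in> sets (borel :: (nat \<Rightarrow> bool) measure)"

end

theory Submission imports Defs begin

text \<open>If \<open>F\<close> is generated by countably many sets, then \<open>M(F)\<close> is equivalent to Cohen forcing: it has
  a dense set isomorphic to the tree of finite sets of natural numbers. Otherwise, since \<open>F\<close> is
  analytic, the first player has a winning strategy in the following game: in each move he plays an
  \<open>F\<close>-positive set \<open>D\<close> and his opponent chooses an element of \<open>D\<close>, and he wins if some set in \<open>F\<close>
  contains none of the chosen elements. If \<open>M(F)\<close> added no eventually different real, then a
  ground model function could guess the generic real well enough to define a play against this
  strategy in which infinitely many of the chosen elements belong to the generic real. This is
  impossible, because the generic real is almost contained in every set in \<open>F\<close>.\<close>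

text \<open>The obstacle in the game argument is that the set offered in a round depends on all
  earlier answers, while a guess reveals only a finite piece of the generic real. So a piece counts
  as useful for a round if it meets the sets offered at all positions from a finite set that is
  fixed in the ground model and will contain the actual position. The hypothesis on eventually
  different reals is applied twice: to a name for bounds, then to a name for finite pieces coded as
  numbers. A guess is right only at infinitely many unknown \<open>n\<close>, so each
  \<open>n\<close> must own a round, and owned rounds may not be adjacent, since a move in one could
  exceed the bound on positions assumed in the next. In the countably generated case, adding one
  point to a stem while shrinking the base set does not give a maximal antichain, because a generic
  real may leave the smaller set later on. The tree therefore branches over finite blocks.\<close>

section \<open>Initial segments and the two forcing orders\<close>

lemma initial_segment_iff:
  assumes "finite t"
  shows "initial_segment t s \<longleftrightarrow> t \<subseteq> s \<and> (\<forall>y\<in>t. \<forall>x\<in>s. x \<le> y \<longrightarrow> x \<in> t)"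
proof
  assume R: "t \<subseteq> s \<and> (\<forall>y\<in>t. \<forall>x\<in>s. x \<le> y \<longrightarrow> x \<in> t)"
  show "initial_segment t s"
  proof (cases "t = {}")
    case True
    then show ?thesis by (auto simp: initial_segment_def intro!: exI[of _ 0])
  next
    case False
    have "t = s \<inter> {..<Suc (Max t)}"
      using R assms Max_in[OF assms False] by (auto simp: less_Suc_eq_le)
    then show ?thesis unfolding initial_segment_def by blast
  qed
qed (auto simp: initial_segment_def)

lemma initial_segment_refl: "finite s \<Longrightarrow> initial_segment s s"
  by (simp add: initial_segment_iff)

lemma initial_segment_trans:
  assumes "initial_segment s t" and "initial_segment t u"
  shows "initial_segment s u"
proof -
  obtain m n where "s = t \<inter> {..<n}" "t = u \<inter> {..<m}"
    using assms unfolding initial_segment_def by blast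
  then have "s = u \<inter> {..<min m n}" by auto
  then show ?thesis unfolding initial_segment_def by blast
qed

lemma initial_segment_subset: "initial_segment t s \<Longrightarrow> t \<subseteq> s"
  by (auto simp: initial_segment_def)

lemma initial_segment_linear:
  assumes "initial_segment s w" and "initial_segment t w"
  shows "initial_segment s t \<or> initial_segment t s"
proof -
  obtain m n where *: "s = w \<inter> {..<n}" "t = w \<inter> {..<m}"
    using assms unfolding initial_segment_def by blast
  then have "s = t \<inter> {..<n}" if "n \<le> m" using that by auto
  moreover from * have "t = s \<inter> {..<m}" if "m \<le> n" using that by auto
  ultimately show ?thesis unfolding initial_segment_def by (meson nle_le)
qed

lemma mathias_le_iff [simp]:
  "mathias_le (s, A) (t, B) \<longleftrightarrow> initial_segment t s \<and> A \<subseteq> B \<and> s - t \<subseteq> B"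
  by (simp add: mathias_le_def)

lemma mathias_conditions_iff [simp]:
  "(s, A) \<in> mathias_conditions F \<longleftrightarrow> finite s \<and> eventually (\<lambda>n. n \<in> A) F"
  by (simp add: mathias_conditions_def)

lemma mathias_le_refl: "p \<in> mathias_conditions F \<Longrightarrow> mathias_le p p"
  by (cases p) (simp add: initial_segment_refl)

lemma mathias_le_trans: "mathias_le p q \<Longrightarrow> mathias_le q r \<Longrightarrow> mathias_le p r"
  by (cases p, cases q, cases r) (auto intro: initial_segment_trans)

lemma cohen_le_refl: "s \<in> cohen_conditions \<Longrightarrow> cohen_le s s"
  by (simp add: cohen_conditions_def cohen_le_def initial_segment_refl)

lemma cohen_le_trans: "cohen_le s t \<Longrightarrow> cohen_le t u \<Longrightarrow> cohen_le s u"
  unfolding cohen_le_def by (rule initial_segment_trans)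

subsection \<open>Dense embeddings\<close>

locale forcing_notion =
  fixes P :: "'p set" and le :: "'p \<Rightarrow> 'p \<Rightarrow> bool"
  assumes refl: "p \<in> P \<Longrightarrow> le p p"
    and trans: "le p q \<Longrightarrow> le q r \<Longrightarrow> le p r"
begin

lemma topspace_forcing: "topspace (forcing_topology P le) = P"
  unfolding topspace_def openin_forcing_topology by blast

lemma openin_cone: "openin (forcing_topology P le) {q \<in> P. le q p}"
  unfolding openin_forcing_topology using trans by blast

lemma closure_of_forcing:
  "forcing_topology P le closure_of U = {p \<in> P. \<exists>q\<in>P. le q p \<and> q \<in> U}"
proof (rule set_eqI)
  fix p
  show "p \<in> forcing_topology P le closure_of U \<longleftrightarrow> p \<in> {p \<in> P. \<exists>q\<in>P. le q p \<and> q \<in> U}"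
  proof
    assume "p \<in> forcing_topology P le closure_of U"
    then have p: "p \<in> P" and "\<And>T. p \<in> T \<Longrightarrow> openin (forcing_topology P le) T \<Longrightarrow> \<exists>y\<in>U. y \<in> T"
      unfolding in_closure_of topspace_forcing by auto
    from this(2)[OF _ openin_cone[of p]] p show "p \<in> {p \<in> P. \<exists>q\<in>P. le q p \<and> q \<in> U}"
      using refl by auto
  next
    assume "p \<in> {p \<in> P. \<exists>q\<in>P. le q p \<and> q \<in> U}"
    then show "p \<in> forcing_topology P le closure_of U"
      unfolding in_closure_of topspace_forcing openin_forcing_topology by blast
  qed
qed

lemma interior_of_forcing:
  "forcing_topology P le interior_of U = {p \<in> P. \<forall>q\<in>P. le q p \<longrightarrow> q \<in> U}"
proof (rule set_eqI)
  fix p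
  show "p \<in> forcing_topology P le interior_of U \<longleftrightarrow> p \<in> {p \<in> P. \<forall>q\<in>P. le q p \<longrightarrow> q \<in> U}"
  proof
    assume "p \<in> {p \<in> P. \<forall>q\<in>P. le q p \<longrightarrow> q \<in> U}"
    then show "p \<in> forcing_topology P le interior_of U"
      unfolding interior_of_def using openin_cone[of p] refl
      by (intro CollectI exI[of _ "{q \<in> P. le q p}"]) auto
  qed (auto simp: interior_of_def openin_forcing_topology)
qed

definition regularize :: "'p set \<Rightarrow> 'p set" where
  "regularize U = {p \<in> P. \<forall>q\<in>P. le q p \<longrightarrow> (\<exists>r\<in>P. le r q \<and> r \<in> U)}"

lemma interior_closure_forcing:
  "forcing_topology P le interior_of (forcing_topology P le closure_of U) = regularize U"
  unfolding interior_of_forcing closure_of_forcing regularize_def by blast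

lemma regular_open_sets_forcing:
  "U \<in> regular_open_sets (forcing_topology P le) \<longleftrightarrow>
     U \<subseteq> P \<and> (\<forall>p\<in>U. \<forall>q\<in>P. le q p \<longrightarrow> q \<in> U) \<and> regularize U = U"
  unfolding regular_open_sets_def interior_closure_forcing openin_forcing_topology by blast

lemma regularize_regular_open:
  assumes U: "U \<subseteq> P" "\<And>p q. p \<in> U \<Longrightarrow> q \<in> P \<Longrightarrow> le q p \<Longrightarrow> q \<in> U"
  shows "regularize U \<in> regular_open_sets (forcing_topology P le)"
proof -
  have "regularize (regularize U) \<subseteq> regularize U"
    unfolding regularize_def using trans refl by (smt (verit) mem_Collect_eq subsetI)
  moreover have "regularize U \<subseteq> regularize (regularize U)"
    unfolding regularize_def using trans refl by (smt (verit) mem_Collect_eq subsetI)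
  moreover have "regularize U \<subseteq> P" "\<forall>p\<in>regularize U. \<forall>q\<in>P. le q p \<longrightarrow> q \<in> regularize U"
    unfolding regularize_def using trans by blast+
  ultimately show ?thesis unfolding regular_open_sets_forcing by blast
qed

lemma ro_Inf_forcing:
  assumes "\<U> \<subseteq> regular_open_sets (forcing_topology P le)"
  shows "ro_Inf (forcing_topology P le) \<U> = P \<inter> \<Inter>\<U>"
  using assms unfolding ro_Inf_def interior_of_forcing subset_iff regular_open_sets_forcing
  using refl by blast

lemma ro_Sup_forcing: "ro_Sup (forcing_topology P le) \<U> = regularize (\<Union>\<U>)"
  unfolding ro_Sup_def interior_closure_forcing ..

lemma ro_compl_forcing:
  "ro_compl (forcing_topology P le) U = {p \<in> P. \<forall>q\<in>P. le q p \<longrightarrow> q \<notin> U}"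
  unfolding ro_compl_def interior_of_forcing topspace_forcing by blast

end

text \<open>The isomorphism sends a regular open set to its preimage under \<open>e\<close>; the
  inverse sends \<open>V\<close> to the regularization of the downward closure of the image of
  \<open>V\<close>.\<close>

lemma forcing_equivalent_dense_embedding:
  fixes P :: "'p set" and Q :: "'q set"
  assumes "forcing_notion P leP" and "forcing_notion Q leQ"
    and e: "\<And>q. q \<in> Q \<Longrightarrow> e q \<in> P"
    and mono: "\<And>q r. q \<in> Q \<Longrightarrow> r \<in> Q \<Longrightarrow> leQ q r \<Longrightarrow> leP (e q) (e r)"
    and incomp: "\<And>q r p. q \<in> Q \<Longrightarrow> r \<in> Q \<Longrightarrow> p \<in> P \<Longrightarrow> leP p (e q) \<Longrightarrow> leP p (e r) \<Longrightarrow>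
       \<exists>u\<in>Q. leQ u q \<and> leQ u r"
    and dense: "\<And>p. p \<in> P \<Longrightarrow> \<exists>q\<in>Q. leP (e q) p"
  shows "forcing_equivalent P leP Q leQ"
proof -
  interpret P: forcing_notion P leP by fact
  interpret Q: forcing_notion Q leQ by fact
  let ?X = "forcing_topology P leP" and ?Y = "forcing_topology Q leQ"
  define h where "h U = {q \<in> Q. e q \<in> U}" for U
  \<comment> \<open>Suprema, surjectivity and regularity of preimages all reduce to this. Density of
    the image leads from \<open>P\<close> to \<open>Q\<close>, and \<open>incomp\<close> returns
    below the given point of \<open>Q\<close>.\<close>
  have h_reg: "h (P.regularize U) = Q.regularize (h U)"
    if U: "U \<subseteq> P" "\<And>p q. p \<in> U \<Longrightarrow> q \<in> P \<Longrightarrow> leP q p \<Longrightarrow> q \<in> U" for U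
  proof (rule set_eqI)
    fix q
    show "q \<in> h (P.regularize U) \<longleftrightarrow> q \<in> Q.regularize (h U)"
    proof
      assume "q \<in> h (P.regularize U)"
      then have q: "q \<in> Q" and *: "\<And>p. p \<in> P \<Longrightarrow> leP p (e q) \<Longrightarrow> \<exists>r\<in>P. leP r p \<and> r \<in> U"
        by (auto simp: h_def P.regularize_def)
      have "\<exists>r\<in>Q. leQ r q' \<and> r \<in> h U" if q': "q' \<in> Q" "leQ q' q" for q'
      proof -
        obtain p where p: "p \<in> P" "leP p (e q')" "p \<in> U" using *[OF e[OF q'(1)] mono] q q' by blast
        obtain q1 where q1: "q1 \<in> Q" "leP (e q1) p" using dense p by blast
        obtain u where u: "u \<in> Q" "leQ u q1" "leQ u q'"
          using incomp[OF q1(1) q'(1) e[OF q1(1)]] P.refl[OF e[OF q1(1)]] P.trans q1 p by blast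
        have "e u \<in> U" using U(2)[OF p(3) e[OF u(1)]] mono[OF u(1) q1(1) u(2)] q1(2) P.trans by blast
        then show ?thesis using u by (auto simp: h_def)
      qed
      then show "q \<in> Q.regularize (h U)" using q by (auto simp: Q.regularize_def)
    next
      assume "q \<in> Q.regularize (h U)"
      then have q: "q \<in> Q" and *: "\<And>p. p \<in> Q \<Longrightarrow> leQ p q \<Longrightarrow> \<exists>r\<in>Q. leQ r p \<and> e r \<in> U"
        by (auto simp: h_def Q.regularize_def)
      have "\<exists>r\<in>P. leP r p \<and> r \<in> U" if p: "p \<in> P" "leP p (e q)" for p
      proof -
        obtain q1 where q1: "q1 \<in> Q" "leP (e q1) p" using dense p by blast
        obtain u where u: "u \<in> Q" "leQ u q1" "leQ u q"
          using incomp[OF q1(1) q e[OF q1(1)]] P.refl[OF e[OF q1(1)]] P.trans q1 p by blast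
        obtain r where r: "r \<in> Q" "leQ r u" "e r \<in> U" using *[OF u(1) u(3)] by blast
        have "leP (e r) p" using mono r u q1 P.trans by (meson Q.trans)
        then show ?thesis using r e by blast
      qed
      then show "q \<in> h (P.regularize U)" using q e by (auto simp: P.regularize_def h_def)
    qed
  qed
  have in_h: "h U \<in> regular_open_sets ?Y" if "U \<in> regular_open_sets ?X" for U
  proof -
    have U: "U \<subseteq> P" "\<And>p q. p \<in> U \<Longrightarrow> q \<in> P \<Longrightarrow> leP q p \<Longrightarrow> q \<in> U" "P.regularize U = U"
      using that unfolding P.regular_open_sets_forcing by blast+
    have "Q.regularize (h U) = h U" using h_reg[of U] U by auto
    moreover have "h U \<subseteq> Q" "\<forall>p\<in>h U. \<forall>q\<in>Q. leQ q p \<longrightarrow> q \<in> h U"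
      using U(2) mono e by (auto simp: h_def)
    ultimately show ?thesis unfolding Q.regular_open_sets_forcing by blast
  qed
  \<comment> \<open>A regular open set is recovered from its trace on the dense image of
    \<open>e\<close>.\<close>
  have sub: "U \<subseteq> U'" if U: "U \<in> regular_open_sets ?X" "U' \<in> regular_open_sets ?X" "h U = h U'" for U U'
  proof
    fix p assume p: "p \<in> U"
    have "\<exists>r\<in>P. leP r p' \<and> r \<in> U'" if p': "p' \<in> P" "leP p' p" for p'
    proof -
      obtain q where q: "q \<in> Q" "leP (e q) p'" using dense p' by blast
      then have "e q \<in> U" using U(1) p p' e P.trans unfolding P.regular_open_sets_forcing by metis
      then have "e q \<in> U'" using U(3) q unfolding h_def by blast
      then show ?thesis using q e by blast
    qed
    then have "p \<in> P.regularize U'"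
      using p U(1) unfolding P.regularize_def P.regular_open_sets_forcing by blast
    then show "p \<in> U'" using U(2) unfolding P.regular_open_sets_forcing by blast
  qed
  have "bij_betw h (regular_open_sets ?X) (regular_open_sets ?Y)"
  proof (rule bij_betw_imageI)
    show "inj_on h (regular_open_sets ?X)" using sub by (intro inj_onI equalityI) metis+
    show "h ` regular_open_sets ?X = regular_open_sets ?Y"
    proof
      show "regular_open_sets ?Y \<subseteq> h ` regular_open_sets ?X"
      proof
        fix V assume V: "V \<in> regular_open_sets ?Y"
        then have V': "V \<subseteq> Q" "\<And>p q. p \<in> V \<Longrightarrow> q \<in> Q \<Longrightarrow> leQ q p \<Longrightarrow> q \<in> V" "Q.regularize V = V"
          unfolding Q.regular_open_sets_forcing by blast+
        define W where "W = {p \<in> P. \<exists>v\<in>V. leP p (e v)}"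
        have W: "W \<subseteq> P" "\<And>p q. p \<in> W \<Longrightarrow> q \<in> P \<Longrightarrow> leP q p \<Longrightarrow> q \<in> W"
          unfolding W_def using P.trans by blast+
        have "h W = V"
        proof
          show "V \<subseteq> h W" using V'(1) e P.refl unfolding h_def W_def by blast
          show "h W \<subseteq> V"
          proof
            fix q assume "q \<in> h W"
            then obtain v where q: "q \<in> Q" and v: "v \<in> V" "leP (e q) (e v)"
              unfolding h_def W_def by blast
            have "\<exists>r\<in>Q. leQ r q' \<and> r \<in> V" if q': "q' \<in> Q" "leQ q' q" for q'
            proof -
              have "leP (e q') (e v)" using mono q q' v P.trans by blast
              then obtain u where "u \<in> Q" "leQ u q'" "leQ u v"
                using incomp[of q' v "e q'"] q' v V'(1) e P.refl by blast
              then show ?thesis using V'(2) v by blast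
            qed
            then have "q \<in> Q.regularize V" using q unfolding Q.regularize_def by blast
            then show "q \<in> V" using V'(3) by simp
          qed
        qed
        then have "h (P.regularize W) = V" using h_reg[of W] W V'(3) by simp
        moreover have "P.regularize W \<in> regular_open_sets ?X"
          using P.regularize_regular_open[of W] W by blast
        ultimately show "V \<in> h ` regular_open_sets ?X" by blast
      qed
    qed (use in_h in blast)
  qed
  moreover have "h (ro_Sup ?X \<U>) = ro_Sup ?Y (h ` \<U>) \<and> h (ro_Inf ?X \<U>) = ro_Inf ?Y (h ` \<U>)"
    if \<U>: "\<U> \<subseteq> regular_open_sets ?X" for \<U>
  proof
    have *: "U \<subseteq> P" "\<And>p q. p \<in> U \<Longrightarrow> q \<in> P \<Longrightarrow> leP q p \<Longrightarrow> q \<in> U" if "U \<in> \<U>" for U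
      using subsetD[OF \<U> that] unfolding P.regular_open_sets_forcing by blast+
    have "h (P.regularize (\<Union>\<U>)) = Q.regularize (h (\<Union>\<U>))"
      by (rule h_reg) (use * in blast)+
    moreover have "h (\<Union>\<U>) = \<Union>(h ` \<U>)" unfolding h_def by blast
    ultimately show "h (ro_Sup ?X \<U>) = ro_Sup ?Y (h ` \<U>)"
      unfolding P.ro_Sup_forcing Q.ro_Sup_forcing by simp
    have "h ` \<U> \<subseteq> regular_open_sets ?Y" using in_h \<U> by blast
    then show "h (ro_Inf ?X \<U>) = ro_Inf ?Y (h ` \<U>)"
      unfolding P.ro_Inf_forcing[OF \<U>] Q.ro_Inf_forcing[OF \<open>h ` \<U> \<subseteq> _\<close>] h_def using e by blast
  qed
  moreover have "h (ro_compl ?X U) = ro_compl ?Y (h U)" if U: "U \<in> regular_open_sets ?X" for U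
  proof (rule set_eqI)
    fix q
    have "\<exists>u\<in>Q. leQ u q \<and> e u \<in> U" if q: "q \<in> Q" and p: "p \<in> P" "leP p (e q)" "p \<in> U" for p
    proof -
      obtain q1 where q1: "q1 \<in> Q" "leP (e q1) p" using dense p by blast
      obtain u where u: "u \<in> Q" "leQ u q1" "leQ u q"
        using incomp[OF q1(1) q e[OF q1(1)]] P.refl[OF e[OF q1(1)]] P.trans q1 p by blast
      have "leP (e u) p" using mono u q1 P.trans by blast
      then show ?thesis using U u p e unfolding P.regular_open_sets_forcing by blast
    qed
    then show "q \<in> h (ro_compl ?X U) \<longleftrightarrow> q \<in> ro_compl ?Y (h U)"
      unfolding P.ro_compl_forcing Q.ro_compl_forcing h_def using e mono by blast
  qed
  ultimately show ?thesis
    unfolding forcing_equivalent_def ro_isomorphism_def by blast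
qed

subsection \<open>Countably generated filters\<close>

definition countably_generated :: "'a filter \<Rightarrow> bool" where
  "countably_generated F \<longleftrightarrow> (\<exists>\<C>. countable \<C> \<and> (\<forall>C\<in>\<C>. eventually (\<lambda>n. n \<in> C) F) \<and>
     (\<forall>A. eventually (\<lambda>n. n \<in> A) F \<longrightarrow> (\<exists>C\<in>\<C>. C \<subseteq> A)))"

lemma eventually_infinite:
  assumes "F \<noteq> bot" "F \<le> cofinite" "eventually (\<lambda>n. n \<in> A) F"
  shows "infinite A"
proof
  assume "finite A"
  then have "eventually (\<lambda>n. n \<notin> A) F"
    using assms(2) by (auto simp: le_filter_def eventually_cofinite)
  with assms(3) have "eventually (\<lambda>_. False) F" by eventually_elim simp
  with assms(1) show False by (simp add: trivial_limit_def)
qed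

lemma eventually_atLeast_cofinite:
  fixes F :: "nat filter"
  assumes "F \<le> cofinite"
  shows "eventually (\<lambda>n. n \<in> {m..}) F"
proof -
  have "eventually (\<lambda>n. n \<in> {m..}) (cofinite :: nat filter)"
    by (simp add: eventually_cofinite not_le)
  then show ?thesis using assms by (auto simp: le_filter_def)
qed

lemma countably_generated_decseq:
  fixes F :: "nat filter"
  assumes "countably_generated F"
  obtains B where "B 0 = UNIV" "\<And>n. eventually (\<lambda>x. x \<in> B n) F" "decseq B"
    "\<And>A. eventually (\<lambda>x. x \<in> A) F \<Longrightarrow> \<exists>n. B n \<subseteq> A"
proof -
  obtain \<C> where \<C>: "countable \<C>" "\<And>C. C \<in> \<C> \<Longrightarrow> eventually (\<lambda>n. n \<in> C) F"
    "\<And>A. eventually (\<lambda>n. n \<in> A) F \<Longrightarrow> \<exists>C\<in>\<C>. C \<subseteq> A"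
    using assms unfolding countably_generated_def by metis
  have ne: "\<C> \<noteq> {}" using \<C>(3)[of UNIV] by auto
  \<comment> \<open>The strict bound makes \<open>B 0\<close> the empty intersection, so that the
    root of the tree is sent to the weakest condition.\<close>
  define B where "B n = (\<Inter>i<n. from_nat_into \<C> i)" for n
  show ?thesis
  proof
    show "B 0 = UNIV" by (simp add: B_def)
    show "eventually (\<lambda>x. x \<in> B n) F" for n
      unfolding B_def using \<C>(2)[OF from_nat_into[OF ne]] by (simp add: eventually_ball_finite)
    show "decseq B" by (force simp: decseq_def B_def)
    show "\<exists>n. B n \<subseteq> A" if A: "eventually (\<lambda>x. x \<in> A) F" for A
    proof -
      obtain C where C: "C \<in> \<C>" "C \<subseteq> A" using \<C>(3)[OF A] by blast
      then obtain i where "from_nat_into \<C> i = C" using from_nat_into_surj[OF \<C>(1)] by blast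
      then have "B (Suc i) \<subseteq> A" using C by (auto simp: B_def)
      then show ?thesis ..
    qed
  qed
qed

section \<open>A dense copy of the Cohen tree inside the Mathias-Prikry forcing\<close>

locale decreasing_base =
  fixes F :: "nat filter" and B :: "nat \<Rightarrow> nat set"
  assumes proper: "F \<noteq> bot" and cof: "F \<le> cofinite"
    and B_0: "B 0 = UNIV"
    and B_in: "\<And>n. eventually (\<lambda>x. x \<in> B n) F"
    and B_dec: "decseq B"
    and B_base: "\<And>A. eventually (\<lambda>x. x \<in> A) F \<Longrightarrow> \<exists>n. B n \<subseteq> A"
begin

text \<open>Below \<open>(s, B n)\<close>, the conditions \<open>(t, B (Suc n))\<close> with \<open>t\<close> in this set form a maximal
  antichain: the set of elements that a generic real has outside \<open>B (Suc n)\<close> is finite, and \<open>t\<close>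
  stops at the first element of the generic real after these and after \<open>s\<close>.\<close>

definition successors :: "nat \<Rightarrow> nat set \<Rightarrow> nat set set" where
  "successors n s = {t. finite t \<and> initial_segment s t \<and> t - s \<subseteq> B n \<and>
     (\<exists>k \<in> t - s. k \<in> B (Suc n) \<and> (\<forall>x\<in>t. x \<le> k) \<and>
        (\<forall>x \<in> t - s. x < k \<longrightarrow> (\<exists>y \<in> t - s. x \<le> y \<and> y < k \<and> y \<notin> B (Suc n))))}"

text \<open>This one-point case, in which the clause on elements before \<open>k\<close> is vacuous,
  is enough to make the antichain infinite.\<close>

lemma insert_in_successors:
  assumes "finite s" "k \<in> B (Suc n)" "\<forall>x\<in>s. x < k"
  shows "insert k s \<in> successors n s"
proof -
  have "k \<notin> s" using assms(3) by blast
  then have diff: "insert k s - s = {k}" by blast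
  have "k \<in> B n" using assms(2) decseqD[OF B_dec, of n "Suc n"] by auto
  moreover have "initial_segment s (insert k s)"
    unfolding initial_segment_iff[OF assms(1)] using assms(3) by (auto dest: leD)
  moreover have "\<forall>x\<in>insert k s. x \<le> k" using assms(3) by (auto intro: less_imp_le)
  ultimately show ?thesis
    using assms(1,2) by (simp add: successors_def diff)
qed

lemma countable_successors: "countable (successors n s)"
  by (rule countable_subset[OF _ countable_Collect_finite]) (auto simp: successors_def)

lemma infinite_Int_greater:
  assumes "eventually (\<lambda>x. x \<in> A) F" "finite s"
  obtains k where "k \<in> A" "\<forall>x\<in>s. x < k"
proof -
  obtain m where m: "\<forall>x\<in>s. x < m" using assms(2) by (metis finite_nat_set_iff_bounded)
  have "infinite A" using eventually_infinite[OF proper cof] assms by blast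
  then obtain k where "k > m" "k \<in> A" by (meson infinite_nat_iff_unbounded)
  then show ?thesis using that m by force
qed

lemma infinite_successors:
  assumes "finite s"
  shows "infinite (successors n s)"
proof
  assume fin: "finite (successors n s)"
  have "finite t" if "t \<in> successors n s" for t using that by (simp add: successors_def)
  with fin have "finite (\<Union>(successors n s))" by (rule finite_Union)
  with assms have fin': "finite (\<Union>(successors n s) \<union> s)" by simp
  obtain k where k: "k \<in> B (Suc n)" "\<forall>x\<in>\<Union>(successors n s) \<union> s. x < k"
    using infinite_Int_greater[OF B_in fin'] .
  have "insert k s \<in> successors n s"
    by (rule insert_in_successors[OF assms k(1)]) (rule ballI, rule bspec[OF k(2)], rule UnI2)
  then have "k \<in> \<Union>(successors n s)" by (rule UnionI) (rule insertI1)
  from bspec[OF k(2) UnI1[OF this]] show False by (rule less_irrefl[THEN notE])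
qed

text \<open>Otherwise the last element \<open>k\<close> of \<open>t\<close> comes before the last
  element of \<open>t'\<close>, so some \<open>y \<ge> k\<close> in \<open>t' - s\<close> lies
  outside \<open>B (Suc n)\<close>. It cannot lie beyond \<open>t\<close>, hence
  \<open>y = k\<close>, but \<open>k\<close> is in \<open>B (Suc n)\<close>.\<close>

lemma successors_antichain_aux:
  assumes t: "t \<in> successors n s" and t': "t' \<in> successors n s"
    and le: "initial_segment t t'" and B: "t' - t \<subseteq> B (Suc n)"
  shows "t = t'"
proof (rule ccontr)
  assume "t \<noteq> t'"
  obtain k where k: "k \<in> t - s" "k \<in> B (Suc n)" "\<forall>x\<in>t. x \<le> k" using t by (auto simp: successors_def)
  obtain k' where k': "k' \<in> t' - s" "\<forall>x\<in>t'. x \<le> k'"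
    "\<forall>x \<in> t' - s. x < k' \<longrightarrow> (\<exists>y \<in> t' - s. x \<le> y \<and> y < k' \<and> y \<notin> B (Suc n))"
    using t' by (auto simp: successors_def)
  have fin: "finite t" "finite t'" using t t' by (auto simp: successors_def)
  have sub: "t \<subseteq> t'" "\<And>x y. y \<in> t \<Longrightarrow> x \<in> t' \<Longrightarrow> x \<le> y \<Longrightarrow> x \<in> t"
    using le unfolding initial_segment_iff[OF fin(1)] by blast+
  then obtain z where z: "z \<in> t'" "z \<notin> t" using \<open>t \<noteq> t'\<close> by blast
  then have "k < z" using sub(2)[of k z] k by (meson DiffD1 leI)
  then have "k < k'" using k' z by force
  then obtain y where y: "y \<in> t' - s" "k \<le> y" "y \<notin> B (Suc n)" using k' k sub by blast
  then have "y \<in> t" using B by blast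
  then have "y = k" using k y by (simp add: order_antisym)
  then show False using k y by blast
qed

lemma successors_antichain:
  assumes t: "t \<in> successors n s" and t': "t' \<in> successors n s"
    and "mathias_le r (t, B (Suc n))" "mathias_le r (t', B (Suc n))"
  shows "t = t'"
proof -
  obtain w C where r: "r = (w, C)" by (cases r)
  have seg: "initial_segment t w" "initial_segment t' w" using assms r by auto
  have sub: "t \<subseteq> w" "t' \<subseteq> w" using seg by (auto dest: initial_segment_subset)
  have B: "w - t \<subseteq> B (Suc n)" "w - t' \<subseteq> B (Suc n)" using assms r by auto
  from initial_segment_linear[OF seg] show ?thesis
  proof
    assume "initial_segment t t'"
    then show ?thesis using successors_antichain_aux[OF t t'] B sub by blast
  next
    assume "initial_segment t' t"
    then show ?thesis using successors_antichain_aux[OF t' t] B sub by blast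
  qed
qed

text \<open>Adding a large \<open>k\<close> from \<open>B (Suc n)\<close> to the stem of
  \<open>r\<close> ensures that a tail of \<open>v - s\<close> lies in \<open>B (Suc n)\<close>.
  Cutting \<open>v\<close> at the least \<open>j\<close> where such a tail begins gives the
  successor; minimality of \<open>j\<close> is its last clause.\<close>

lemma successors_predense:
  assumes r: "r \<in> mathias_conditions F" and le: "mathias_le r (s, B n)" and s: "finite s"
  obtains t r' where "t \<in> successors n s" "r' \<in> mathias_conditions F" "mathias_le r' r"
    "mathias_le r' (t, B (Suc n))"
proof -
  obtain w A where rw: "r = (w, A)" by (cases r)
  have w: "finite w" "initial_segment s w" "A \<subseteq> B n" "w - s \<subseteq> B n" and A: "eventually (\<lambda>x. x \<in> A) F"
    using r le rw by auto
  have ev: "eventually (\<lambda>x. x \<in> A \<inter> B (Suc n)) F" using A B_in[of "Suc n"] by (simp add: eventually_conj_iff)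
  obtain k where k: "k \<in> A \<inter> B (Suc n)" "\<forall>x\<in>w. x < k" using infinite_Int_greater[OF ev w(1)] by blast
  define v where "v = insert k w"
  have sw: "s \<subseteq> w" "\<And>x y. y \<in> s \<Longrightarrow> x \<in> w \<Longrightarrow> x \<le> y \<Longrightarrow> x \<in> s"
    using w(2) unfolding initial_segment_iff[OF s] by blast+
  define Q where "Q j \<longleftrightarrow> j \<in> v - s \<and> (\<forall>y\<in>v - s. j \<le> y \<longrightarrow> y \<in> B (Suc n))" for j
  have "Q k" using k sw by (force simp: Q_def v_def)
  define j where "j = (LEAST j. Q j)"
  have j: "Q j" "\<And>i. Q i \<Longrightarrow> j \<le> i" unfolding j_def using LeastI[of Q, OF \<open>Q k\<close>] Least_le[of Q] by blast+
  have vB: "v - s \<subseteq> B n" using w k by (auto simp: v_def)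
  have sv: "s \<subseteq> v" "\<And>x y. y \<in> s \<Longrightarrow> x \<in> v \<Longrightarrow> x \<le> y \<Longrightarrow> x \<in> s"
    using sw k by (auto simp: v_def) (meson leD subsetD)
  define t where "t = v \<inter> {..j}"
  have fint: "finite t" by (simp add: t_def)
  have sj: "x < j" if "x \<in> s" for x using sv(2)[OF that, of j] j(1) by (meson DiffE Q_def leI)
  have st: "s \<subseteq> t" using sv sj by (auto simp: t_def intro: less_imp_le)
  have "t \<in> successors n s"
  proof -
    have "\<exists>y\<in>t - s. x \<le> y \<and> y < j \<and> y \<notin> B (Suc n)" if x: "x \<in> t - s" "x < j" for x
    proof -
      have "\<not> Q x" using j(2)[of x] x by auto
      then obtain y where "y \<in> v - s" "x \<le> y" "y \<notin> B (Suc n)" using x by (auto simp: Q_def t_def)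
      moreover then have "y < j" using j(1) by (auto simp: Q_def not_less[symmetric])
      ultimately show ?thesis by (auto simp: t_def)
    qed
    moreover have "initial_segment s t" unfolding initial_segment_iff[OF s] using st sv by (auto simp: t_def)
    moreover have "t - s \<subseteq> B n" using vB by (auto simp: t_def)
    moreover have "j \<in> t - s" "j \<in> B (Suc n)" "\<forall>x\<in>t. x \<le> j" using j by (auto simp: Q_def t_def)
    ultimately show ?thesis using fint unfolding successors_def by blast
  qed
  moreover have "(v, A \<inter> B (Suc n)) \<in> mathias_conditions F" using ev w by (simp add: v_def)
  moreover have "mathias_le (v, A \<inter> B (Suc n)) r"
    using k w rw by (auto simp: v_def initial_segment_iff)
  moreover have "mathias_le (v, A \<inter> B (Suc n)) (t, B (Suc n))"
  proof -
    have "initial_segment t v" unfolding initial_segment_iff[OF fint] by (auto simp: t_def)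
    moreover have "v - t \<subseteq> B (Suc n)"
    proof
      fix x assume x: "x \<in> v - t"
      then have "j < x" by (auto simp: t_def)
      moreover from this have "x \<notin> s" using sj[of x] by auto
      ultimately show "x \<in> B (Suc n)" using j(1) x by (simp add: Q_def)
    qed
    ultimately show ?thesis by simp
  qed
  ultimately show ?thesis using that by blast
qed

text \<open>The index set consists of the possible new last elements of the node \<open>s\<close>,
  so its children are matched with the antichain below the stem \<open>t\<close> attached to
  \<open>s\<close>. A bijection exists because both sets are countably infinite.\<close>

definition successor_enum :: "nat \<Rightarrow> nat set \<Rightarrow> nat set \<Rightarrow> nat \<Rightarrow> nat set" where
  "successor_enum n t s = (SOME f. bij_betw f {k. \<forall>x\<in>s. x < k} (successors n t))"

lemma bij_successor_enum:
  assumes "finite s" "finite t"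
  shows "bij_betw (successor_enum n t s) {k. \<forall>x\<in>s. x < k} (successors n t)"
proof -
  obtain m where m: "\<forall>x\<in>s. x < m" using assms(1) by (metis finite_nat_set_iff_bounded)
  have "infinite {m..}" by (simp add: infinite_Ici)
  moreover have "{m..} \<subseteq> {k. \<forall>x\<in>s. x < k}" using m by force
  ultimately have "infinite {k. \<forall>x\<in>s. x < k}" using finite_subset by blast
  then have "bij_betw (from_nat_into (successors n t) \<circ> to_nat_on {k. \<forall>x\<in>s. x < k})
      {k. \<forall>x\<in>s. x < k} (successors n t)"
    using bij_betw_from_nat_into[OF countable_successors infinite_successors[OF assms(2)]]
    by (intro bij_betw_trans[OF to_nat_on_infinite]) auto
  then show ?thesis unfolding successor_enum_def by (rule someI[of "\<lambda>f. bij_betw f _ _"])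
qed

text \<open>Removing the maximum gives the parent node, whose level is \<open>card s - 1\<close>.
  Infinite sets get a dummy value.\<close>

function stem :: "nat set \<Rightarrow> nat set" where
  "stem s = (if finite s \<and> s \<noteq> {}
     then successor_enum (card s - 1) (stem (s - {Max s})) (s - {Max s}) (Max s) else {})"
  by auto
termination
proof (relation "Wellfounded.measure card", goal_cases)
  case (2 s)
  then have "card (s - {Max s}) < card s" by (intro card_Diff1_less) auto
  then show ?case by simp
qed simp

declare stem.simps [simp del]

lemma stem_empty: "stem {} = {}"
  by (subst stem.simps) simp

lemma stem_insert:
  assumes "finite s" "\<forall>x\<in>s. x < k"
  shows "stem (insert k s) = successor_enum (card s) (stem s) s k"
proof -
  have "Max (insert k s) = k" using assms by (intro Max_eqI) (auto intro: less_imp_le)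
  moreover have "k \<notin> s" using assms by blast
  ultimately show ?thesis using assms by (subst stem.simps) (simp add: insert_Diff_if)
qed

lemma finite_stem:
  assumes "finite s"
  shows "finite (stem s)"
  using assms
proof (induction rule: finite_linorder_max_induct)
  case (insert k s)
  then have "stem (insert k s) \<in> successors (card s) (stem s)"
    using bij_betwE[OF bij_successor_enum[of s "stem s" "card s"]] stem_insert by auto
  then show ?case by (simp add: successors_def)
qed (simp add: stem_empty)

lemma stem_insert_in:
  assumes "finite s" "\<forall>x\<in>s. x < k"
  shows "stem (insert k s) \<in> successors (card s) (stem s)"
  using bij_betwE[OF bij_successor_enum[of s "stem s" "card s"]] stem_insert finite_stem assms by auto

text \<open>Each step down the tree lengthens the stem; \<open>embed_dense\<close> uses this to
  outgrow the stem of a given condition.\<close>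

lemma card_stem_ge:
  assumes "finite s"
  shows "card s \<le> card (stem s)"
  using assms
proof (induction rule: finite_linorder_max_induct)
  case (insert k s)
  then have *: "stem (insert k s) \<in> successors (card s) (stem s)" using stem_insert_in by blast
  then have "stem s \<subset> stem (insert k s)" by (auto simp: successors_def dest: initial_segment_subset)
  moreover have "finite (stem (insert k s))" using * by (auto simp: successors_def)
  ultimately have "card (stem s) < card (stem (insert k s))" by (rule psubset_card_mono[rotated])
  moreover have "k \<notin> s" using insert by blast
  ultimately show ?case using insert by simp
qed simp

definition embed :: "nat set \<Rightarrow> nat set \<times> nat set" where
  "embed s = (stem s, B (card s))"

lemma embed_in: "finite s \<Longrightarrow> embed s \<in> mathias_conditions F"
  by (simp add: embed_def finite_stem B_in)

lemma embed_insert_le: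
  assumes "finite s" "\<forall>x\<in>s. x < k"
  shows "mathias_le (embed (insert k s)) (embed s)"
proof -
  have "k \<notin> s" using assms by blast
  then show ?thesis
    using stem_insert_in[OF assms] decseqD[OF B_dec, of "card s" "Suc (card s)"] assms(1)
    by (simp add: embed_def successors_def)
qed

lemma embed_mono:
  assumes "finite s" "initial_segment t s"
  shows "mathias_le (embed s) (embed t)"
  using assms
proof (induction arbitrary: t rule: finite_linorder_max_induct)
  case empty
  then show ?case
    using mathias_le_refl[OF embed_in, of "{}"] by (auto simp: initial_segment_def)
next
  case (insert k s)
  have fin: "finite t" using insert finite_subset[OF initial_segment_subset] by blast
  show ?case
  proof (cases "k \<in> t")
    case True
    then have "t = insert k s"
      using insert(2,4) unfolding initial_segment_iff[OF fin] by (auto intro: less_imp_le)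
    then show ?thesis using mathias_le_refl embed_in insert(1) by blast
  next
    case False
    then have "initial_segment t s" using insert(4) unfolding initial_segment_iff[OF fin] by blast
    then show ?thesis using insert(3) embed_insert_le[OF insert(1,2)] mathias_le_trans by blast
  qed
qed

text \<open>Once the parent \<open>s\<close> is an initial segment of \<open>s'\<close>, the child
  \<open>insert k s\<close> and the child of \<open>s\<close> towards \<open>s'\<close> are sent
  into one antichain with common extension \<open>r\<close>. So their stems agree, and injectivity
  of the enumeration makes \<open>k\<close> the next element of \<open>s'\<close>.\<close>

lemma embed_compatible:
  assumes "finite s" "finite s'" "card s \<le> card s'"
    and "mathias_le r (embed s)" "mathias_le r (embed s')"
  shows "initial_segment s s'"
  using assms
proof (induction rule: finite_linorder_max_induct)
  case empty
  then show ?case by (simp add: initial_segment_iff)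
next
  case (insert k s)
  have "k \<notin> s" using insert by blast
  then have card: "card s < card s'" using insert by simp
  have "mathias_le r (embed s)" using insert embed_insert_le mathias_le_trans by blast
  then have seg: "initial_segment s s'" using insert card by simp
  have "s' - s \<noteq> {}" using card insert(1) card_mono[of s s'] by fastforce
  define k' where "k' = Min (s' - s)"
  have k': "k' \<in> s' - s" "\<And>x. x \<in> s' - s \<Longrightarrow> k' \<le> x"
    using Min_in[of "s' - s"] Min_le[of "s' - s"] insert(4) \<open>s' - s \<noteq> {}\<close> unfolding k'_def by auto
  have above: "\<forall>x\<in>s. x < k'"
    using seg k'(1) unfolding initial_segment_iff[OF insert(1)] by (meson DiffE leI)
  have seg': "initial_segment (insert k' s) s'"
  proof -
    have "s \<subseteq> s'" "\<And>x y. y \<in> s \<Longrightarrow> x \<in> s' \<Longrightarrow> x \<le> y \<Longrightarrow> x \<in> s"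
      using seg unfolding initial_segment_iff[OF insert(1)] by blast+
    then show ?thesis using k' insert(1) by (auto simp: initial_segment_iff dest!: order_antisym)
  qed
  have le': "mathias_le r (embed (insert k' s))" using embed_mono[OF insert(4) seg'] insert mathias_le_trans by blast
  have "k' \<notin> s" using k' by blast
  then have "stem (insert k s) = stem (insert k' s)"
    using insert \<open>k \<notin> s\<close> le' stem_insert_in[OF insert(1,2)] stem_insert_in[OF insert(1) above]
    by (intro successors_antichain) (auto simp: embed_def)
  then have "successor_enum (card s) (stem s) s k = successor_enum (card s) (stem s) s k'"
    using stem_insert insert above by auto
  then have "k = k'"
    using bij_betw_imp_inj_on[OF bij_successor_enum[OF insert(1) finite_stem[OF insert(1)]]] insert(2) above
    by (auto dest: inj_onD)
  then show ?case using seg' by simp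
qed

lemma embed_level:
  assumes "p \<in> mathias_conditions F"
  shows "\<exists>s r. finite s \<and> card s = l \<and> r \<in> mathias_conditions F \<and> mathias_le r p \<and> mathias_le r (embed s)"
proof (induction l)
  case 0
  have "mathias_le p (embed {})"
    by (cases p) (simp add: embed_def stem_empty B_0 initial_segment_iff)
  then show ?case using mathias_le_refl[OF assms] assms by (intro exI[of _ "{}"] exI[of _ p]) simp
next
  case (Suc l)
  then obtain s r where s: "finite s" "card s = l" and r: "r \<in> mathias_conditions F" "mathias_le r p" "mathias_le r (embed s)"
    by blast
  obtain t r' where t: "t \<in> successors l (stem s)" "r' \<in> mathias_conditions F" "mathias_le r' r"
    "mathias_le r' (t, B (Suc l))"
    using successors_predense[OF r(1) _ finite_stem[OF s(1)], of l] r s by (auto simp: embed_def)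
  obtain k where k: "\<forall>x\<in>s. x < k" "t = successor_enum l (stem s) s k"
    using bij_betw_imp_surj_on[OF bij_successor_enum[OF s(1) finite_stem[OF s(1)], of l]] t(1) by blast
  then have "t = stem (insert k s)" using stem_insert s by simp
  moreover have "k \<notin> s" using k by blast
  ultimately have "mathias_le r' (embed (insert k s))" using t s by (simp add: embed_def)
  moreover have "card (insert k s) = Suc l" "finite (insert k s)" using s \<open>k \<notin> s\<close> by auto
  ultimately show ?case using t r mathias_le_trans by blast
qed

text \<open>On a level of at least \<open>m\<close> and \<open>card w\<close>, the second coordinate
  lies inside \<open>A\<close>, and the stem is comparable with \<open>w\<close> and long enough to
  extend it. The common extension shows that the elements added to \<open>w\<close> lie in
  \<open>A\<close>.\<close>

lemma embed_dense:
  assumes "p \<in> mathias_conditions F"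
  shows "\<exists>s. finite s \<and> mathias_le (embed s) p"
proof -
  obtain w A where p: "p = (w, A)" "finite w" "eventually (\<lambda>x. x \<in> A) F" using assms by (cases p) auto
  obtain m where m: "B m \<subseteq> A" using B_base p by blast
  obtain s v C where s: "finite s" "card s = max m (card w)" and le: "mathias_le (v, C) p" "mathias_le (v, C) (embed s)"
    using embed_level[OF assms, of "max m (card w)"] by auto
  have "B (card s) \<subseteq> A" using decseqD[OF B_dec, of m "card s"] s m by auto
  moreover have v: "initial_segment w v" "initial_segment (stem s) v" "v - w \<subseteq> A"
    using le p by (auto simp: embed_def)
  moreover have "initial_segment w (stem s)"
    using initial_segment_linear[OF v(1,2)]
  proof
    assume *: "initial_segment (stem s) w"
    have "card w \<le> card (stem s)" using card_stem_ge[OF s(1)] s by simp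
    then have "stem s = w" using card_seteq[OF p(2) initial_segment_subset[OF *]] by blast
    then show ?thesis using p by (simp add: initial_segment_refl)
  qed
  ultimately have "mathias_le (embed s) p"
    using p initial_segment_subset[OF v(2)] by (auto simp: embed_def)
  then show ?thesis using s by blast
qed

lemma mathias_equivalent_cohen:
  "forcing_equivalent (mathias_conditions F) mathias_le cohen_conditions cohen_le"
proof (rule forcing_equivalent_dense_embedding[where e = embed])
  show "forcing_notion (mathias_conditions F) mathias_le"
    by unfold_locales (auto intro: mathias_le_refl mathias_le_trans)
  show "forcing_notion cohen_conditions cohen_le"
    by unfold_locales (auto intro: cohen_le_refl cohen_le_trans)
  show "\<exists>u\<in>cohen_conditions. cohen_le u q \<and> cohen_le u r"
    if "q \<in> cohen_conditions" "r \<in> cohen_conditions" "mathias_le p (embed q)" "mathias_le p (embed r)" for q r p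
  proof -
    have fin: "finite q" "finite r" using that by (auto simp: cohen_conditions_def)
    have "initial_segment q r \<or> initial_segment r q"
      using embed_compatible[OF fin _ that(3,4)] embed_compatible[OF fin(2,1) _ that(4,3)] by linarith
    then show ?thesis
      using fin by (auto simp: cohen_conditions_def cohen_le_def intro: initial_segment_refl)
  qed
qed (auto simp: cohen_conditions_def cohen_le_def embed_in embed_mono embed_dense)

end

lemma countably_generated_equivalent_cohen:
  assumes "F \<noteq> bot" "F \<le> cofinite" "countably_generated F"
  shows "forcing_equivalent (mathias_conditions F) mathias_le cohen_conditions cohen_le"
proof -
  obtain B where "B 0 = UNIV" "\<And>n. eventually (\<lambda>x. x \<in> B n) F" "decseq B"
    "\<And>A. eventually (\<lambda>x. x \<in> A) F \<Longrightarrow> \<exists>n. B n \<subseteq> A"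
    using countably_generated_decseq[OF assms(3)] by blast
  with assms interpret decreasing_base F B by unfold_locales
  show ?thesis by (rule mathias_equivalent_cohen)
qed

subsection \<open>Analytic filters\<close>

text \<open>Closedness in the product of Cantor and Baire space, put in terms of finite
  approximations because the tree argument needs violations to be visible at a finite stage.\<close>

definition closed_relation :: "((nat \<Rightarrow> bool) \<Rightarrow> (nat \<Rightarrow> nat) \<Rightarrow> bool) \<Rightarrow> bool" where
  "closed_relation R \<longleftrightarrow>
     (\<forall>x y. \<not> R x y \<longrightarrow> (\<exists>n. \<forall>x' y'. (\<forall>i<n. x' i = x i \<and> y' i = y i) \<longrightarrow> \<not> R x' y'))"

definition analytic_set :: "(nat \<Rightarrow> bool) set \<Rightarrow> bool" where
  "analytic_set X \<longleftrightarrow> (\<exists>R. closed_relation R \<and> X = {x. \<exists>y. R x y})"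

lemma analytic_set_coordinate: "analytic_set {x. x i \<in> A}"
  unfolding analytic_set_def closed_relation_def
proof (intro exI[of _ "\<lambda>x y. x i \<in> A"] conjI allI impI)
  fix x :: "nat \<Rightarrow> bool" and y :: "nat \<Rightarrow> nat" assume "x i \<notin> A"
  then show "\<exists>n. \<forall>x' (y' :: nat \<Rightarrow> nat). (\<forall>i<n. x' i = x i \<and> y' i = y i) \<longrightarrow> x' i \<notin> A"
    by (intro exI[of _ "Suc i"]) auto
qed simp

lemma analytic_set_UN:
  assumes "\<And>i :: nat. analytic_set (X i)"
  shows "analytic_set (\<Union>i. X i)"
proof -
  obtain R where R: "\<And>i. closed_relation (R i)" and X: "\<And>i. X i = {x. \<exists>y. R i x y}"
    using assms unfolding analytic_set_def by metis
  define S where "S x y \<longleftrightarrow> R (y 0) x (\<lambda>k. y (Suc k))" for x y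
  have "closed_relation S"
    unfolding closed_relation_def
  proof (intro allI impI)
    fix x y assume S: "\<not> S x y"
    show "\<exists>n. \<forall>x' y'. (\<forall>i<n. x' i = x i \<and> y' i = y i) \<longrightarrow> \<not> S x' y'"
    proof -
      obtain n where n: "\<And>x' y'. \<forall>j<n. x' j = x j \<and> y' j = y (Suc j) \<Longrightarrow> \<not> R (y 0) x' y'"
        using R[unfolded closed_relation_def] S unfolding S_def by blast
      have "\<not> S x' y'" if "\<forall>i<Suc n. x' i = x i \<and> y' i = y i" for x' y'
        using n[of x' "\<lambda>k. y' (Suc k)"] that by (auto simp: S_def)
      then show ?thesis by blast
    qed
  qed
  moreover have "(\<Union>i. X i) = {x. \<exists>y. S x y}"
  proof (intro set_eqI iffI)
    fix x assume "x \<in> (\<Union>i. X i)"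
    then obtain i y where "R i x y" using X by blast
    then have "S x (case_nat i y)" by (simp add: S_def)
    then show "x \<in> {x. \<exists>y. S x y}" by blast
  qed (auto simp: X S_def)
  ultimately show ?thesis unfolding analytic_set_def by blast
qed

text \<open>One sequence codes a witness for each \<open>i\<close> as its \<open>i\<close>-th row. A
  violation occurs in a single row, hence shows in finitely many entries.\<close>

lemma analytic_set_INT:
  assumes "\<And>i :: nat. analytic_set (X i)"
  shows "analytic_set (\<Inter>i. X i)"
proof -
  obtain R where R: "\<And>i. closed_relation (R i)" and X: "\<And>i. X i = {x. \<exists>y. R i x y}"
    using assms unfolding analytic_set_def by metis
  define S where "S x y \<longleftrightarrow> (\<forall>i. R i x (\<lambda>k. y (prod_encode (i, k))))" for x y
  have "closed_relation S"
    unfolding closed_relation_def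
  proof (intro allI impI)
    fix x y assume S: "\<not> S x y"
    show "\<exists>n. \<forall>x' y'. (\<forall>i<n. x' i = x i \<and> y' i = y i) \<longrightarrow> \<not> S x' y'"
    proof -
      obtain i n where n: "\<And>x' y'. \<forall>j<n. x' j = x j \<and> y' j = y (prod_encode (i, j)) \<Longrightarrow> \<not> R i x' y'"
        using R[unfolded closed_relation_def] S unfolding S_def by blast
      obtain m where m: "\<forall>j\<in>insert n ((\<lambda>j. prod_encode (i, j)) ` {..<n}). j < m"
        by (metis finite_nat_set_iff_bounded finite_imageI finite_insert finite_lessThan)
      have "\<not> S x' y'" if "\<forall>i<m. x' i = x i \<and> y' i = y i" for x' y'
        using n[of x' "\<lambda>k. y' (prod_encode (i, k))"] that m by (auto simp: S_def)
      then show ?thesis by blast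
    qed
  qed
  moreover have "(\<Inter>i. X i) = {x. \<exists>y. S x y}"
  proof (intro set_eqI iffI)
    fix x assume "x \<in> (\<Inter>i. X i)"
    then have "\<forall>i. \<exists>y. R i x y" using X by blast
    then obtain y where y: "\<And>i. R i x (y i)" by metis
    then have "S x (\<lambda>m. case prod_decode m of (i, k) \<Rightarrow> y i k)" by (simp add: S_def)
    then show "x \<in> {x. \<exists>y. S x y}" by blast
  qed (auto simp: X S_def)
  ultimately show ?thesis unfolding analytic_set_def by blast
qed

text \<open>Used to identify the Borel sets with the product sigma-algebra, whose generators
  constrain one coordinate.\<close>

instance bool :: second_countable_topology
proof
  show "\<exists>B :: bool set set. countable B \<and> open = generate_topology B"
    by (intro exI[of _ "range lessThan \<union> range greaterThan"]) (auto simp: open_bool_def)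
qed

lemma borel_imp_analytic_set:
  assumes "X \<in> sets (borel :: (nat \<Rightarrow> bool) measure)"
  shows "analytic_set X"
proof -
  have "X \<in> sets (Pi\<^sub>M UNIV (\<lambda>_ :: nat. borel :: bool measure))"
    using assms by (simp add: sets_PiM_equal_borel)
  then have "X \<in> sigma_sets UNIV {{f. f i \<in> A} | i A. A \<in> sets (borel :: bool measure)}"
    by (simp add: sets_PiM_single PiE_UNIV_domain Pi_def)
  \<comment> \<open>Analytic sets need not be closed under complements, so the induction carries the
    complement along.\<close>
  then have "analytic_set X \<and> analytic_set (UNIV - X)"
  proof (induction rule: sigma_sets.induct)
    case (Basic X)
    then obtain i :: nat and A where X: "X = {f. f i \<in> A}" by blast
    have "UNIV - X = {f. f i \<in> - A}" using X by auto
    then show ?case using analytic_set_coordinate[of i A] analytic_set_coordinate[of i "- A"] X by metis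
  next
    case Empty
    show ?case using analytic_set_coordinate[of 0 "{}"] analytic_set_coordinate[of 0 UNIV] by simp
  next
    case (Compl X)
    then show ?case by (simp add: double_diff)
  next
    case (Union X)
    have "UNIV - (\<Union>i. X i) = (\<Inter>i. UNIV - X i)" by blast
    then show ?case using Union analytic_set_UN[of X] analytic_set_INT[of "\<lambda>i. UNIV - X i"] by auto
  qed
  then show ?thesis ..
qed

text \<open>If \<open>F\<close> is analytic but not countably generated, remove from a tree representing \<open>F\<close> all
  nodes whose projection is covered by countably many cones \<open>{A. C \<subseteq> A}\<close> with \<open>C \<in> F\<close>. In the
  remaining tree, the intersection of the projection of the cone above a node is never in \<open>F\<close>,
  so its complement \<open>D\<close> is positive, and any element of \<open>D\<close> can be avoided by passing to an
  extension of the node. This is a winning strategy for the first player in a Rothberger game.\<close>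

lemma analytic_filter_strategy:
  fixes F :: "nat filter"
  assumes an: "analytic_set {x. eventually x F}" and ncg: "\<not> countably_generated F"
  obtains D :: "nat list \<Rightarrow> nat set"
  where "\<And>\<sigma> A. eventually (\<lambda>n. n \<in> A) F \<Longrightarrow> A \<inter> D \<sigma> \<noteq> {}"
    and "\<And>a. \<exists>A. eventually (\<lambda>n. n \<in> A) F \<and> (\<forall>n. a n \<in> D (map a [0..<n]) \<longrightarrow> a n \<notin> A)"
proof -
  obtain R :: "(nat \<Rightarrow> bool) \<Rightarrow> (nat \<Rightarrow> nat) \<Rightarrow> bool"
    where closed: "closed_relation R" and F: "{x. eventually x F} = {x. \<exists>y. R x y}"
    using an[unfolded analytic_set_def] by (elim exE conjE)
  have F_iff: "eventually x F \<longleftrightarrow> (\<exists>y. R x y)" for x using F by (simp add: set_eq_iff)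
  define S where "S z \<longleftrightarrow> R (\<lambda>i. fst (z i)) (\<lambda>i. snd (z i))" for z :: "nat \<Rightarrow> bool \<times> nat"
  define val where "val z = {i. fst (z i)}" for z :: "nat \<Rightarrow> bool \<times> nat"
  have S_closed: "\<exists>n. \<forall>z'. (\<forall>i<n. z' i = z i) \<longrightarrow> \<not> S z'" if "\<not> S z" for z
  proof -
    from closed[unfolded closed_relation_def, rule_format, OF that[unfolded S_def]]
    obtain n where n: "\<forall>x' y'. (\<forall>i<n. x' i = fst (z i) \<and> y' i = snd (z i)) \<longrightarrow> \<not> R x' y'"
      by (elim exE)
    show ?thesis unfolding S_def by (rule exI[of _ n]) (use n in simp)
  qed
  have val_in: "eventually (\<lambda>n. n \<in> val z) F" if "S z" for z
    unfolding F_iff using that unfolding val_def S_def by auto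
  have val_ex: "\<exists>z. S z \<and> val z = A" if A: "eventually (\<lambda>n. n \<in> A) F" for A
  proof -
    obtain y where "R (\<lambda>n. n \<in> A) y" using A unfolding F_iff by blast
    then show ?thesis by (intro exI[of _ "\<lambda>i. (i \<in> A, y i)"]) (simp add: S_def val_def)
  qed
  define base where "base \<C> \<longleftrightarrow> countable \<C> \<and> (\<forall>C\<in>\<C>. eventually (\<lambda>n. n \<in> C) F)" for \<C>
  \<comment> \<open>The small sets form a sigma-ideal. That the set of all branches is not small is
    the failure of countable generation.\<close>
  define small where "small Z \<longleftrightarrow> (\<exists>\<C>. base \<C> \<and> (\<forall>z\<in>Z. \<exists>C\<in>\<C>. C \<subseteq> val z))" for Z
  have base_UN: "base (\<Union>i\<in>I. \<C> i)" if "countable I" "\<And>i. i \<in> I \<Longrightarrow> base (\<C> i)"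
    for I :: "(bool \<times> nat) list set" and \<C>
    using that unfolding base_def by auto
  have small_subset: "small Z" if "small Z'" "Z \<subseteq> Z'" for Z Z'
    using that unfolding small_def by (meson subsetD)
  have small_UN: "small (\<Union>i\<in>I. Z i)" if I: "countable I" "\<And>i. i \<in> I \<Longrightarrow> small (Z i)"
    for I :: "(bool \<times> nat) list set" and Z
  proof -
    have "\<forall>i\<in>I. \<exists>\<C>. base \<C> \<and> (\<forall>z\<in>Z i. \<exists>C\<in>\<C>. C \<subseteq> val z)"
      using I(2) unfolding small_def by simp
    from bchoice[OF this] obtain \<C>
      where \<C>: "\<forall>i\<in>I. base (\<C> i) \<and> (\<forall>z\<in>Z i. \<exists>C\<in>\<C> i. C \<subseteq> val z)" by (elim exE)
    have "base (\<Union>i\<in>I. \<C> i)" by (rule base_UN[OF I(1)]) (use \<C> in simp)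
    moreover have "\<forall>z\<in>(\<Union>i\<in>I. Z i). \<exists>C\<in>(\<Union>i\<in>I. \<C> i). C \<subseteq> val z"
    proof
      fix z assume "z \<in> (\<Union>i\<in>I. Z i)"
      then obtain i where i: "i \<in> I" "z \<in> Z i" by (elim UN_E)
      with \<C> obtain C where "C \<in> \<C> i" "C \<subseteq> val z" by meson
      with i(1) show "\<exists>C\<in>(\<Union>i\<in>I. \<C> i). C \<subseteq> val z" by (meson UN_I)
    qed
    ultimately show ?thesis unfolding small_def by (intro exI conjI)
  qed
  have small_Un: "small (Z \<union> Z')" if "small Z" "small Z'" for Z Z'
  proof -
    obtain \<C> where \<C>: "base \<C>" "\<forall>z\<in>Z. \<exists>C\<in>\<C>. C \<subseteq> val z"
      using \<open>small Z\<close> unfolding small_def by (elim exE conjE)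
    obtain \<C>' where \<C>': "base \<C>'" "\<forall>z\<in>Z'. \<exists>C\<in>\<C>'. C \<subseteq> val z"
      using \<open>small Z'\<close> unfolding small_def by (elim exE conjE)
    have "base (\<C> \<union> \<C>')" using \<C>(1) \<C>'(1) by (auto simp: base_def)
    moreover have "\<forall>z\<in>Z \<union> Z'. \<exists>C\<in>\<C> \<union> \<C>'. C \<subseteq> val z" using \<C>(2) \<C>'(2) by (meson UnCI UnE)
    ultimately show ?thesis unfolding small_def by (intro exI[of _ "\<C> \<union> \<C>'"] conjI)
  qed
  define thru where "thru p = {z. S z \<and> map z [0..<length p] = p}" for p
  define big where "big p \<longleftrightarrow> \<not> small (thru p)" for p
  define kern where "kern p = {z \<in> thru p. \<forall>n \<ge> length p. big (map z [0..<n])}" for p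
  define E where "E p = {i. \<exists>z\<in>kern p. i \<notin> val z}" for p
  have big_Nil: "big []"
  proof (rule ccontr)
    assume "\<not> big []"
    then obtain \<C> where \<C>: "base \<C>" "\<forall>z\<in>thru []. \<exists>C\<in>\<C>. C \<subseteq> val z"
      unfolding big_def small_def by auto
    have "\<exists>C\<in>\<C>. C \<subseteq> A" if "eventually (\<lambda>n. n \<in> A) F" for A
      using val_ex[OF that] \<C>(2) by (auto simp: thru_def)
    with \<C>(1) have "countably_generated F"
      unfolding countably_generated_def base_def by (intro exI[of _ \<C>]) simp
    then show False using ncg by blast
  qed
  \<comment> \<open>If \<open>A\<close> missed \<open>E p\<close>, then \<open>{A}\<close> would
    cover the kernel. All other branches through \<open>p\<close> pass one of the countably many
    nodes that are not big, so \<open>thru p\<close> would be small.\<close>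
  have E_positive: "A \<inter> E p \<noteq> {}" if p: "big p" and A: "eventually (\<lambda>n. n \<in> A) F" for p A
  proof
    assume "A \<inter> E p = {}"
    then have "\<forall>z\<in>kern p. A \<subseteq> val z" unfolding E_def by blast
    moreover have "base {A}" using A by (simp add: base_def)
    ultimately have "small (kern p)" unfolding small_def by (intro exI[of _ "{A}"]) simp
    moreover have "small (\<Union>q\<in>{q. \<not> big q}. thru q)"
      by (rule small_UN) (auto simp: big_def)
    ultimately have "small (kern p \<union> (\<Union>q\<in>{q. \<not> big q}. thru q))" by (rule small_Un)
    moreover have "thru p \<subseteq> kern p \<union> (\<Union>q\<in>{q. \<not> big q}. thru q)"
      unfolding kern_def by (auto simp: thru_def)
    ultimately show False using p small_subset unfolding big_def by blast
  qed
  \<comment> \<open>The extension excludes \<open>i\<close> if \<open>i\<close> is in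
    \<open>E p\<close>, and lengthens \<open>p\<close> in every case so that the nodes converge to a
    branch. For other \<open>p\<close> the claim is void, which permits a total choice
    function.\<close>
  have "\<exists>q. big p \<longrightarrow> big q \<and> length p < length q \<and> take (length p) q = p \<and>
      (i \<in> E p \<longrightarrow> i < length q \<and> \<not> fst (q ! i))" for p i
  proof (cases "big p")
    case True
    obtain z where z: "z \<in> kern p" "i \<in> E p \<Longrightarrow> i \<notin> val z"
      using E_positive[OF True, of UNIV] unfolding E_def by auto
    define q where "q = map z [0..<Suc (max i (length p))]"
    have "map z [0..<length p] = p" using z by (simp add: kern_def thru_def)
    then have "take (length p) q = p" by (simp add: q_def take_map del: upt_Suc)
    moreover have "big q" using z(1) unfolding kern_def q_def by (auto simp del: upt_Suc)
    moreover have "length p < length q" "i < length q" "q ! i = z i"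
      by (auto simp: q_def nth_append simp del: upt_Suc)
    ultimately show ?thesis using z(2) unfolding val_def by (intro exI[of _ q]) auto
  qed simp
  then obtain step where step: "\<And>p i. big p \<Longrightarrow> big (step p i) \<and> length p < length (step p i) \<and>
      take (length p) (step p i) = p \<and> (i \<in> E p \<longrightarrow> i < length (step p i) \<and> \<not> fst (step p i ! i))"
    by metis
  define D where "D \<sigma> = E (foldl step [] \<sigma>)" for \<sigma>
  have big_node: "big (foldl step [] \<sigma>)" for \<sigma>
    by (induction \<sigma> rule: rev_induct) (auto simp: big_Nil step)
  show ?thesis
  proof (rule that[of D])
    show "A \<inter> D \<sigma> \<noteq> {}" if "eventually (\<lambda>n. n \<in> A) F" for \<sigma> A
      unfolding D_def using E_positive big_node that by blast
    fix a :: "nat \<Rightarrow> nat"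
    define P where "P n = foldl step [] (map a [0..<n])" for n
    have P_Suc: "P (Suc n) = step (P n) (a n)" for n by (simp add: P_def)
    have P_big: "big (P n)" for n unfolding P_def by (rule big_node)
    have P_step: "length (P n) < length (P (Suc n))" "take (length (P n)) (P (Suc n)) = P n" for n
      using step[OF P_big] unfolding P_Suc by blast+
    have len: "n \<le> length (P n)" for n
      by (induction n) (use P_step(1) in \<open>auto simp: Suc_le_eq intro: le_less_trans\<close>)
    have prefix: "length (P n) \<le> length (P m) \<and> take (length (P n)) (P m) = P n" if "n \<le> m" for n m
      using that
    proof (induction rule: dec_induct)
      case (step m)
      have "take (length (P n)) (P (Suc m)) = take (length (P n)) (take (length (P m)) (P (Suc m)))"
        using step by (simp add: min_absorb1)
      also have "\<dots> = P n" using step P_step(2) by simp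
      finally show ?case using step P_step(1)[of m] by simp
    qed simp
    have nth: "P n ! i = P m ! i" if "n \<le> m" "i < length (P n)" for n m i
      using prefix[OF that(1)] that(2) by (metis nth_take)
    define z where "z i = P (Suc i) ! i" for i
    have z: "z i = P n ! i" if "i < length (P n)" for i n
      using nth[of n "Suc i" i] nth[of "Suc i" n i] that len[of "Suc i"] unfolding z_def
      by (metis Suc_le_eq nle_le)
    have "S z"
    proof (rule ccontr)
      assume "\<not> S z"
      then obtain n where n: "\<And>z'. \<forall>i<n. z' i = z i \<Longrightarrow> \<not> S z'" using S_closed by blast
      \<comment> \<open>The empty set is small, so a big node carries an element of
        \<open>S\<close>. It agrees with the limit \<open>z\<close> up to \<open>n\<close>, contrary
        to the choice of \<open>n\<close>.\<close>
      have "thru (P n) \<noteq> {}"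
        using P_big[of n] unfolding big_def small_def by (auto simp: base_def)
      then obtain z' where z': "S z'" "map z' [0..<length (P n)] = P n" unfolding thru_def by blast
      have "z' i = z i" if "i < n" for i
      proof -
        have i: "i < length (P n)" using that len[of n] by simp
        then have "P n ! i = z' i" using arg_cong[OF z'(2), of "\<lambda>l. l ! i"] by simp
        then show ?thesis using z[OF i] by simp
      qed
      then show False using n z' by blast
    qed
    moreover have "a n \<notin> val z" if "a n \<in> D (map a [0..<n])" for n
    proof -
      have "a n \<in> E (P n)" using that by (simp add: D_def P_def)
      then have "a n < length (P (Suc n))" "\<not> fst (P (Suc n) ! a n)"
        using step[OF P_big, of n "a n"] unfolding P_Suc by auto
      then show ?thesis using z by (simp add: val_def)
    qed
    ultimately show "\<exists>A. eventually (\<lambda>n. n \<in> A) F \<and> (\<forall>n. a n \<in> D (map a [0..<n]) \<longrightarrow> a n \<notin> A)"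
      using val_in by blast
  qed
qed

subsection \<open>Eventually different reals\<close>

lemma not_forces_exD:
  "\<not> forces_ex P le \<phi> p \<Longrightarrow> \<exists>q\<in>P. le q p \<and> (\<forall>r\<in>P. le r q \<longrightarrow> (\<forall>x. \<not> \<phi> x r))"
  unfolding forces_ex_def dense_below_def by blast

text \<open>A name for a real is read off from \<open>\<psi>\<close>: its value at \<open>n\<close> is some \<open>m\<close> with \<open>\<psi> u n m\<close>, where
  \<open>u\<close> is the shortest initial segment of the generic real for which there is such an \<open>m\<close>.\<close>

lemma no_eventually_different_realD:
  fixes F :: "nat filter" and \<psi> :: "nat set \<Rightarrow> nat \<Rightarrow> nat \<Rightarrow> bool"
  defines "P \<equiv> mathias_conditions F"
  assumes no: "\<not> adds_eventually_different_real P mathias_le" and p: "p \<in> P"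
    and dense: "\<And>s A n. (s, A) \<in> P \<Longrightarrow> mathias_le (s, A) p \<Longrightarrow>
      \<exists>t m. finite t \<and> initial_segment s t \<and> t - s \<subseteq> A \<and> \<psi> t n m"
  obtains f q where "q \<in> P" "mathias_le q p"
    "\<And>r N. r \<in> P \<Longrightarrow> mathias_le r q \<Longrightarrow>
      \<exists>n\<ge>N. \<exists>r'\<in>P. mathias_le r' r \<and> (\<exists>u. initial_segment u (fst r') \<and> \<psi> u n (f n))"
proof -
  \<comment> \<open>Reading the value at the least cut makes it unique and stable under
    end-extension of the stem; \<open>SOME\<close> settles ties.\<close>
  define least where "least t n j \<longleftrightarrow> (\<exists>m. \<psi> (t \<inter> {..<j}) n m) \<and> (\<forall>i<j. \<nexists>m. \<psi> (t \<inter> {..<i}) n m)"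
    for t n and j :: nat
  define \<phi> where "\<phi> t n m \<longleftrightarrow> (\<exists>j. least t n j \<and> m = (SOME m. \<psi> (t \<inter> {..<j}) n m))" for t n m
  have least_unique: "i = j" if "least t n i" "least t n j" for t n i j
    using that unfolding least_def by (meson linorder_neqE_nat)
  have \<phi>_unique: "m = m'" if "\<phi> t n m" "\<phi> t n m'" for t n m m'
    using that least_unique unfolding \<phi>_def by blast
  have \<phi>_mono: "\<phi> t' n m" if seg: "initial_segment t t'" and \<phi>: "\<phi> t n m" for t t' n m
  proof -
    obtain N where t: "t = t' \<inter> {..<N}" using seg unfolding initial_segment_def by blast
    obtain j where j: "least t n j" "m = (SOME m. \<psi> (t \<inter> {..<j}) n m)" using \<phi> unfolding \<phi>_def by blast
    have "j \<le> N"
    proof (rule ccontr)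
      assume "\<not> j \<le> N"
      then have "t \<inter> {..<j} = t \<inter> {..<N}" using t by auto
      then show False using j(1) \<open>\<not> j \<le> N\<close> unfolding least_def by (metis not_le)
    qed
    then have "t \<inter> {..<i} = t' \<inter> {..<i}" if "i \<le> j" for i using t that by auto
    then have "least t' n j" "m = (SOME m. \<psi> (t' \<inter> {..<j}) n m)"
      using j unfolding least_def by auto
    then show ?thesis unfolding \<phi>_def by blast
  qed
  have \<phi>_ex: "\<exists>m. \<phi> t n m" if t: "finite t" "\<psi> t n m" for t n m
  proof -
    obtain J where "\<forall>x\<in>t. x < J" using t(1) by (metis finite_nat_set_iff_bounded)
    then have "t \<inter> {..<J} = t" by auto
    then have "\<exists>m. \<psi> (t \<inter> {..<J}) n m" using t(2) by auto
    then have "least t n (LEAST j. \<exists>m. \<psi> (t \<inter> {..<j}) n m)"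
      unfolding least_def using LeastI[of "\<lambda>j. \<exists>m. \<psi> (t \<inter> {..<j}) n m" J] not_less_Least by blast
    then show ?thesis unfolding \<phi>_def by blast
  qed
  have \<phi>_\<psi>: "\<exists>u. initial_segment u t \<and> \<psi> u n m" if "\<phi> t n m" for t n m
  proof -
    obtain j where "least t n j" "m = (SOME m. \<psi> (t \<inter> {..<j}) n m)"
      using \<open>\<phi> t n m\<close> unfolding \<phi>_def by blast
    then have "\<psi> (t \<inter> {..<j}) n m" unfolding least_def by (metis someI_ex)
    then show ?thesis unfolding initial_segment_def by blast
  qed
  \<comment> \<open>The side condition is \<open>UNIV\<close> because \<open>\<phi>\<close> depends
    on the stem alone.\<close>
  define \<tau> where "\<tau> = {((n, m), (t, UNIV :: nat set)) | n m t. finite t \<and> \<phi> t n m}"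
  have \<tau>: "\<tau> \<subseteq> UNIV \<times> P" by (auto simp: \<tau>_def P_def)
  have mem_intro: "forces_mem P mathias_le (n, m) \<tau> (s, A)" if s: "(s, A) \<in> P" "\<phi> s n m" for s A n m
    unfolding forces_mem_def dense_below_def
  proof (intro ballI impI)
    fix q assume q: "q \<in> P" "mathias_le q (s, A)"
    have "((n, m), (s, UNIV)) \<in> \<tau>" using s by (simp add: \<tau>_def P_def)
    moreover have "mathias_le q (s, UNIV)" using q by (cases q) simp
    ultimately show "\<exists>r\<in>P. mathias_le r q \<and> r \<in> {q. \<exists>r. ((n, m), r) \<in> \<tau> \<and> mathias_le q r}"
      using q(1) mathias_le_refl[of q F] unfolding P_def by blast
  qed
  have mem_dest: "\<exists>r\<in>P. mathias_le r q' \<and> \<phi> (fst r) n m"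
    if mem: "forces_mem P mathias_le (n, m) \<tau> q" "q' \<in> P" "mathias_le q' q" for n m q q'
  proof -
    obtain r t where "r \<in> P" "mathias_le r q'" "\<phi> t n m" "mathias_le r (t, UNIV)"
      using mem unfolding forces_mem_def dense_below_def \<tau>_def by blast
    then show ?thesis using \<phi>_mono[of t "fst r"] by (cases r) auto
  qed
  have "forces_real P mathias_le \<tau> p"
    unfolding forces_real_def
  proof (intro conjI allI impI)
    fix n
    show "forces_ex P mathias_le (\<lambda>m. forces_mem P mathias_le (n, m) \<tau>) p"
      unfolding forces_ex_def dense_below_def
    proof (intro ballI impI)
      fix q assume q: "q \<in> P" "mathias_le q p"
      obtain s A where sA: "q = (s, A)" by (cases q)
      obtain t m where t: "finite t" "initial_segment s t" "t - s \<subseteq> A" "\<psi> t n m"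
        using dense q sA by blast
      obtain m' where "\<phi> t n m'" using \<phi>_ex t by blast
      moreover have "(t, A) \<in> P" using q sA t by (simp add: P_def)
      ultimately have "forces_mem P mathias_le (n, m') \<tau> (t, A)" using mem_intro by blast
      moreover have "mathias_le (t, A) q" using sA t by simp
      ultimately show "\<exists>r\<in>P. mathias_le r q \<and> r \<in> {q. \<exists>m. forces_mem P mathias_le (n, m) \<tau> q}"
        using \<open>(t, A) \<in> P\<close> by blast
    qed
  next
    fix n m m' :: nat assume "m \<noteq> m'"
    show "forces_not P mathias_le
      (\<lambda>q. forces_mem P mathias_le (n, m) \<tau> q \<and> forces_mem P mathias_le (n, m') \<tau> q) p"
      unfolding forces_not_def
    proof (intro ballI impI notI)
      fix q assume q: "q \<in> P"
        "forces_mem P mathias_le (n, m) \<tau> q \<and> forces_mem P mathias_le (n, m') \<tau> q"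
      obtain r where r: "r \<in> P" "mathias_le r q" "\<phi> (fst r) n m"
        using mem_dest q mathias_le_refl[of q F] unfolding P_def by blast
      obtain r' where r': "r' \<in> P" "mathias_le r' r" "\<phi> (fst r') n m'" using mem_dest q r by blast
      have "initial_segment (fst r) (fst r')" using r'(2) by (cases r, cases r') simp
      then have "\<phi> (fst r') n m" using \<phi>_mono r(3) by blast
      then show False using \<phi>_unique r'(3) \<open>m \<noteq> m'\<close> by blast
    qed
  qed
  then have "\<not> forces_eventually_different P mathias_le \<tau> p"
    using no p \<tau> unfolding adds_eventually_different_real_def by blast
  then have "\<exists>f. \<not> forces_ex P mathias_le (\<lambda>S q. finite S \<and>
      (\<forall>n. n \<notin> S \<longrightarrow> forces_not P mathias_le (forces_mem P mathias_le (n, f n) \<tau>) q)) p"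
    unfolding forces_eventually_different_def by (simp only: not_all not_False_eq_True)
  then obtain f where f: "\<not> forces_ex P mathias_le (\<lambda>S q. finite S \<and>
      (\<forall>n. n \<notin> S \<longrightarrow> forces_not P mathias_le (forces_mem P mathias_le (n, f n) \<tau>) q)) p" ..
  from not_forces_exD[OF f] obtain q where q: "q \<in> P" "mathias_le q p"
    and *: "\<And>r S. r \<in> P \<Longrightarrow> mathias_le r q \<Longrightarrow> finite S \<Longrightarrow>
      \<exists>n. n \<notin> S \<and> \<not> forces_not P mathias_le (forces_mem P mathias_le (n, f n) \<tau>) r"
    by auto
  show ?thesis
  proof (rule that[OF q])
    fix r N assume r: "r \<in> P" "mathias_le r q"
    obtain n where n: "n \<notin> {..<N}" "\<not> forces_not P mathias_le (forces_mem P mathias_le (n, f n) \<tau>) r"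
      using *[OF r, of "{..<N}"] by auto
    then obtain r1 where r1: "r1 \<in> P" "mathias_le r1 r" "forces_mem P mathias_le (n, f n) \<tau> r1"
      unfolding forces_not_def by blast
    obtain r2 where r2: "r2 \<in> P" "mathias_le r2 r1" "\<phi> (fst r2) n (f n)"
      using mem_dest[OF r1(3,1)] mathias_le_refl[of r1 F] r1(1) unfolding P_def by blast
    then show "\<exists>n\<ge>N. \<exists>r'\<in>P. mathias_le r' r \<and> (\<exists>u. initial_segment u (fst r') \<and> \<psi> u n (f n))"
      using n(1) \<phi>_\<psi>[OF r2(3)] mathias_le_trans[OF r2(2) r1(2)] by (intro exI[of _ n]) auto
  qed
qed

section \<open>Intervals, and the choice of separated rounds\<close>

lemma interval_of_strict_mono:
  fixes m :: "nat \<Rightarrow> nat"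
  assumes "strict_mono m" "m 0 = 0"
  obtains j where "m j \<le> k" "k < m (Suc j)"
proof -
  have "k < m (Suc k)" using strict_mono_imp_increasing[OF assms(1), of "Suc k"] by simp
  then have ex: "\<exists>i. k < m i" ..
  define i where "i = (LEAST i. k < m i)"
  have i: "k < m i" unfolding i_def using ex by (rule LeastI_ex)
  then obtain j where j: "i = Suc j" using assms(2) by (cases i) auto
  then have "\<not> k < m j" using not_less_Least[of j "\<lambda>i. k < m i"] by (simp add: i_def)
  then show ?thesis using that[of j] i j by simp
qed

text \<open>Greedy choice: an earlier value forbids itself and its two neighbours, so at most
  \<open>3 * n\<close> numbers are forbidden at stage \<open>n\<close>. Truncation of
  \<open>c i - 1\<close> at \<open>0\<close> only repeats a value.\<close>

lemma spaced_choice: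
  fixes G :: "nat \<Rightarrow> nat set"
  shows "\<exists>c. inj c \<and> (\<forall>i n. c n \<noteq> Suc (c i)) \<and> (\<forall>n. 3 * n + 1 \<le> card (G n) \<longrightarrow> c n \<in> G n)"
proof -
  let ?bad = "\<lambda>c n. (\<Union>i\<in>{..<n}. {c i, Suc (c i), c i - 1 :: nat})"
  have "\<exists>c. \<forall>n. c n \<notin> ?bad c n \<and> (3 * n + 1 \<le> card (G n) \<longrightarrow> c n \<in> G n)"
  proof (rule dependent_wf_choice[OF wf_less_than])
    fix c :: "nat \<Rightarrow> nat" and n
    have "finite (?bad c n)" by simp
    have "card (?bad c n) \<le> (\<Sum>i\<in>{..<n}. card {c i, Suc (c i), c i - 1})" by (rule card_UN_le) simp
    also have "\<dots> \<le> of_nat (card {..<n}) * 3"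
      by (rule sum_bounded_above) (auto simp: card_insert_if)
    finally have card: "card (?bad c n) \<le> 3 * n" by simp
    show "\<exists>r. r \<notin> ?bad c n \<and> (3 * n + 1 \<le> card (G n) \<longrightarrow> r \<in> G n)"
    proof (cases "3 * n + 1 \<le> card (G n)")
      case True
      have "\<not> G n \<subseteq> ?bad c n"
        using card_mono[OF \<open>finite (?bad c n)\<close>, of "G n"] card True by linarith
      then show ?thesis by blast
    next
      case False
      obtain r where "r \<notin> ?bad c n" using ex_new_if_finite[OF infinite_UNIV_nat \<open>finite (?bad c n)\<close>] ..
      then show ?thesis using False by blast
    qed
  qed auto
  then obtain c where c: "\<And>n. c n \<notin> ?bad c n" "\<And>n. 3 * n + 1 \<le> card (G n) \<Longrightarrow> c n \<in> G n"
    by blast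
  have lt: "c n \<noteq> c i \<and> c n \<noteq> Suc (c i) \<and> c i \<noteq> Suc (c n)" if "i < n" for i n
  proof -
    have "c n \<notin> {c i, Suc (c i), c i - 1}" using c(1)[of n] that by blast
    then show ?thesis by auto
  qed
  show ?thesis
  proof (intro exI conjI allI impI)
    show "c n \<noteq> Suc (c i)" for i n
      using lt[of i n] lt[of n i] by (metis linorder_neqE_nat n_not_Suc_n)
    show "inj c" using lt by (intro injI) (metis linorder_neqE_nat)
  qed (rule c(2))
qed

text \<open>A name \<open>d\<close> bounds, for positions \<open>\<sigma>\<close> in the finite set \<open>\<Sigma> k\<close>, the least element above \<open>k\<close>
  that the generic real has in \<open>D \<sigma>\<close>. As \<open>d\<close> is not dominating, some ground model sequence \<open>m\<close>
  has infinitely many \<open>j\<close> such that every \<open>D \<sigma>\<close> with \<open>\<sigma>\<close> in \<open>\<Sigma> (m j)\<close> is met between \<open>m j\<close> and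
  \<open>m (j + 2)\<close>. A ground model function that infinitely often guesses an initial segment with
  enough such \<open>j\<close> then yields moves \<open>a\<close> against the strategy, and the generic real contains
  infinitely many of them.\<close>

lemma strategy_imp_adds_eventually_different_real:
  fixes F :: "nat filter" and D :: "nat list \<Rightarrow> nat set"
  assumes cof: "F \<le> cofinite"
    and pos: "\<And>\<sigma> A. eventually (\<lambda>n. n \<in> A) F \<Longrightarrow> A \<inter> D \<sigma> \<noteq> {}"
    and avoid: "\<And>a. \<exists>A. eventually (\<lambda>n. n \<in> A) F \<and> (\<forall>n. a n \<in> D (map a [0..<n]) \<longrightarrow> a n \<notin> A)"
  shows "adds_eventually_different_real (mathias_conditions F) mathias_le"
proof (rule ccontr)
  assume no: "\<not> ?thesis"
  let ?P = "mathias_conditions F"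
  define \<Sigma> where "\<Sigma> k = {\<sigma>. set \<sigma> \<subseteq> {..<k} \<and> length \<sigma> \<le> k}" for k :: nat
  have fin_\<Sigma>: "finite (\<Sigma> k)" for k unfolding \<Sigma>_def by (rule finite_lists_length_le) simp
  have \<Sigma>_mono: "\<Sigma> k \<subseteq> \<Sigma> l" if "k \<le> l" for k l using that unfolding \<Sigma>_def by auto
  have Nil_\<Sigma>: "[] \<in> \<Sigma> k" for k by (simp add: \<Sigma>_def)
  define \<psi>1 where "\<psi>1 t k b \<longleftrightarrow> (\<forall>\<sigma>\<in>\<Sigma> k. t \<inter> D \<sigma> \<inter> {k..<b} \<noteq> {})" for t k b
  have dense1: "\<exists>t b. finite t \<and> initial_segment s t \<and> t - s \<subseteq> A \<and> \<psi>1 t k b"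
    if s: "finite s" and A: "eventually (\<lambda>n. n \<in> A) F" for s A k
  proof -
    obtain l where l: "\<forall>x\<in>s. x < l" using s by (metis finite_nat_set_iff_bounded)
    have "eventually (\<lambda>n. n \<in> A \<inter> {max k l..}) F"
      using A eventually_atLeast_cofinite[OF cof, of "max k l"] by (simp add: eventually_conj_iff)
    then have "\<exists>x. x \<in> A \<inter> {max k l..} \<inter> D \<sigma>" for \<sigma> using pos by blast
    then obtain x where x: "\<And>\<sigma>. x \<sigma> \<in> A \<inter> {max k l..} \<inter> D \<sigma>" by metis
    define t where "t = s \<union> x ` \<Sigma> k"
    have fin: "finite t" using s fin_\<Sigma> by (simp add: t_def)
    obtain b where b: "\<forall>y\<in>t. y < b" using fin by (metis finite_nat_set_iff_bounded)
    have "l \<le> x \<sigma>" for \<sigma> using x[of \<sigma>] by simp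
    then have "initial_segment s t"
      unfolding initial_segment_iff[OF s] using l by (auto simp: t_def) (meson leD le_trans)
    moreover have "t - s \<subseteq> A" using x by (auto simp: t_def)
    moreover have "x \<sigma> \<in> t \<inter> D \<sigma> \<inter> {k..<b}" if "\<sigma> \<in> \<Sigma> k" for \<sigma>
    proof -
      have "x \<sigma> \<in> t" using that by (simp add: t_def)
      then show ?thesis using x[of \<sigma>] b by auto
    qed
    then have "\<psi>1 t k b" unfolding \<psi>1_def by blast
    ultimately show ?thesis using fin by blast
  qed
  obtain f q1 where q1: "q1 \<in> ?P" and f: "\<And>r N. r \<in> ?P \<Longrightarrow> mathias_le r q1 \<Longrightarrow>
      \<exists>k\<ge>N. \<exists>r'\<in>?P. mathias_le r' r \<and> (\<exists>u. initial_segment u (fst r') \<and> \<psi>1 u k (f k))"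
    by (rule no_eventually_different_realD[OF no, of "({}, UNIV)" \<psi>1]) (use dense1 in auto)
  \<comment> \<open>The sum bounds all earlier values of \<open>f\<close>, which need not be
    monotone.\<close>
  define m where "m n = ((\<lambda>k. Suc (k + (\<Sum>i\<le>k. f i))) ^^ n) 0" for n
  have m0: "m 0 = 0" and mSuc: "m (Suc n) = Suc (m n + (\<Sum>i\<le>m n. f i))" for n
    by (simp_all add: m_def)
  have m_mono: "strict_mono m" by (rule strict_mono_Suc_iff[THEN iffD2]) (simp add: mSuc)
  have m_ge: "n \<le> m n" for n by (rule strict_mono_imp_increasing[OF m_mono])
  have f_le: "f k \<le> m (Suc n)" if "k \<le> m n" for k n
  proof -
    have "f k \<le> (\<Sum>i\<le>m n. f i)" by (rule member_le_sum) (use that in auto)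
    then show ?thesis by (simp add: mSuc)
  qed
  \<comment> \<open>The window spans two intervals: the \<open>k\<close> at which \<open>f\<close>
    guesses correctly lies anywhere in the interval from \<open>m j\<close> to
    \<open>m (Suc j)\<close>, so \<open>f k\<close> is only bounded by
    \<open>m (Suc (Suc j))\<close>.\<close>
  define good where "good t j \<longleftrightarrow> (\<forall>\<sigma>\<in>\<Sigma> (m j). t \<inter> D \<sigma> \<inter> {m j..<m (Suc (Suc j))} \<noteq> {})" for t j
  have good_mono: "good t' j" if "good t j" "t \<subseteq> t'" for t t' j
    using that unfolding good_def by blast
  have good_less: "j < b" if "good t j" "\<forall>x\<in>t. x < b" for t j b
  proof -
    obtain x where "x \<in> t" "m j \<le> x" using \<open>good t j\<close> Nil_\<Sigma> unfolding good_def by fastforce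
    then show ?thesis using that(2) m_ge[of j] by fastforce
  qed
  have good_ex: "\<exists>j\<ge>N. \<exists>r'\<in>?P. mathias_le r' r \<and> good (fst r') j" if r: "r \<in> ?P" "mathias_le r q1" for r N
  proof -
    obtain k r' u where k: "m N \<le> k" and r': "r' \<in> ?P" "mathias_le r' r"
      and u: "initial_segment u (fst r')" "\<psi>1 u k (f k)" using f[OF r] by blast
    obtain j where j: "m j \<le> k" "k < m (Suc j)" using interval_of_strict_mono[OF m_mono m0] .
    have "N \<le> j" using k j(2) strict_mono_less[OF m_mono, of N "Suc j"] by simp
    moreover have "good (fst r') j" unfolding good_def
    proof
      fix \<sigma> assume "\<sigma> \<in> \<Sigma> (m j)"
      then have "\<sigma> \<in> \<Sigma> k" using \<Sigma>_mono[OF j(1)] by blast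
      then obtain x where x: "x \<in> u" "x \<in> D \<sigma>" "k \<le> x" "x < f k" using u(2) unfolding \<psi>1_def by fastforce
      moreover have "f k \<le> m (Suc (Suc j))" using f_le j(2) by simp
      moreover have "x \<in> fst r'" using x(1) initial_segment_subset[OF u(1)] by blast
      ultimately show "fst r' \<inter> D \<sigma> \<inter> {m j..<m (Suc (Suc j))} \<noteq> {}" using j(1) by force
    qed
    ultimately show ?thesis using r' by blast
  qed
  \<comment> \<open>Good rounds stay good when the stem grows, and a stem below \<open>b\<close> has
    good rounds only below \<open>b\<close>. So each use of \<open>good_ex\<close> with bound
    \<open>b\<close> adds a new one.\<close>
  have good_many: "\<exists>r'\<in>?P. mathias_le r' r \<and> c \<le> card {j. good (fst r') j}"
    if r: "r \<in> ?P" "mathias_le r q1" for r c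
  proof (induction c)
    case 0
    show ?case using r mathias_le_refl[OF r(1)] by (intro bexI[of _ r]) simp_all
  next
    case (Suc c)
    then obtain r1 where r1: "r1 \<in> ?P" "mathias_le r1 r" "c \<le> card {j. good (fst r1) j}" by blast
    have "finite (fst r1)" using r1(1) by (cases r1) simp
    then obtain b where b: "\<forall>x\<in>fst r1. x < b" by (metis finite_nat_set_iff_bounded)
    obtain j r2 where j: "b \<le> j" and r2: "r2 \<in> ?P" "mathias_le r2 r1" "good (fst r2) j"
      using good_ex[OF r1(1) mathias_le_trans[OF r1(2) r(2)]] by blast
    have "finite (fst r2)" using r2(1) by (cases r2) simp
    then obtain b2 where b2: "\<forall>x\<in>fst r2. x < b2" by (metis finite_nat_set_iff_bounded)
    have "fst r1 \<subseteq> fst r2" using r2(2) by (cases r1, cases r2) (auto dest: initial_segment_subset)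
    then have sub: "insert j {j. good (fst r1) j} \<subseteq> {j. good (fst r2) j}" using good_mono r2(3) by blast
    have fin1: "finite {j. good (fst r1) j}"
      by (rule finite_subset[of _ "{..<b}"]) (use good_less[OF _ b] in auto)
    have fin2: "finite {j. good (fst r2) j}"
      by (rule finite_subset[of _ "{..<b2}"]) (use good_less[OF _ b2] in auto)
    have "j \<notin> {j. good (fst r1) j}" using good_less[OF _ b, of j] j by auto
    then have "Suc c \<le> card (insert j {j. good (fst r1) j})" using fin1 r1(3) by simp
    also have "\<dots> \<le> card {j. good (fst r2) j}" using card_mono[OF fin2 sub] .
    finally show ?case using r2 mathias_le_trans[OF r2(2) r1(2)] by blast
  qed
  \<comment> \<open>The value codes the whole stem, so a correct guess reveals it; the count is the
    one required by \<open>spaced_choice\<close>.\<close>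
  define \<psi>2 where "\<psi>2 t n v \<longleftrightarrow> t = set_decode v \<and> 3 * n + 1 \<le> card {j. good t j}" for t n v
  have dense2: "\<exists>t v. finite t \<and> initial_segment s t \<and> t - s \<subseteq> A \<and> \<psi>2 t n v"
    if s: "(s, A) \<in> ?P" "mathias_le (s, A) q1" for s A n
  proof -
    obtain t B where t: "(t, B) \<in> ?P" "mathias_le (t, B) (s, A)" "3 * n + 1 \<le> card {j. good t j}"
      using good_many[OF s, of "3 * n + 1"] by auto
    then have "\<psi>2 t n (set_encode t)" by (simp add: \<psi>2_def)
    then show ?thesis using t by auto
  qed
  show False
  proof (rule no_eventually_different_realD[OF no q1 dense2])
    fix g q2 assume q2: "q2 \<in> ?P" "mathias_le q2 q1" and g: "\<And>r N. r \<in> ?P \<Longrightarrow> mathias_le r q2 \<Longrightarrow>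
      \<exists>n\<ge>N. \<exists>r'\<in>?P. mathias_le r' r \<and> (\<exists>u. initial_segment u (fst r') \<and> \<psi>2 u n (g n))"
    define U where "U n = set_decode (g n)" for n
    obtain c where "inj c \<and> (\<forall>i n. c n \<noteq> Suc (c i)) \<and>
        (\<forall>n. 3 * n + 1 \<le> card {j. good (U n) j} \<longrightarrow> c n \<in> {j. good (U n) j})"
      using spaced_choice[of "\<lambda>n. {j. good (U n) j}"] by (elim exE)
    then have c: "\<And>i n. c n \<noteq> Suc (c i)" "inj c"
      "\<And>n. 3 * n + 1 \<le> card {j. good (U n) j} \<Longrightarrow> good (U n) (c n)" by simp_all
    define hit where "hit j \<sigma> x \<longleftrightarrow> (\<exists>n. c n = j \<and> x \<in> U n \<inter> D \<sigma> \<inter> {m j..<m (Suc (Suc j))})" for j \<sigma> x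
    \<comment> \<open>Rounds without a hit get the move \<open>0\<close>, which respects every bound
      on moves used below.\<close>
    define h where "h j \<sigma> = (if \<exists>x. hit j \<sigma> x then SOME x. hit j \<sigma> x else 0)" for j \<sigma>
    have h_hit: "hit j \<sigma> (h j \<sigma>)" if "hit j \<sigma> x" for j \<sigma> x
      using that unfolding h_def by (auto intro: someI)
    define b where "b = rec_nat [] (\<lambda>j \<sigma>. \<sigma> @ [h j \<sigma>])"
    define a where "a j = h j (b j)" for j
    have b: "b j = map a [0..<j]" for j by (induction j) (simp_all add: b_def a_def)
    obtain A where A: "eventually (\<lambda>n. n \<in> A) F" "\<And>n. a n \<in> D (b n) \<Longrightarrow> a n \<notin> A"
      using avoid[of a] unfolding b by blast
    have a_less: "a i < m (Suc (Suc i))" for i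
    proof (cases "\<exists>x. hit i (b i) x")
      case True
      then show ?thesis using h_hit unfolding a_def hit_def by fastforce
    next
      case False
      then show ?thesis using m_ge[of "Suc (Suc i)"] by (simp add: a_def h_def)
    qed
    \<comment> \<open>A move in round \<open>i\<close> is only known to be below
      \<open>m (Suc (Suc i))\<close>, too weak for the round just before \<open>c n\<close>. Spacing
      helps there: that round is not of the form \<open>c i\<close>, so its move is
      \<open>0\<close>.\<close>
    have b_\<Sigma>: "b (c n) \<in> \<Sigma> (m (c n))" for n
    proof -
      have "a i < m (c n)" if i: "i < c n" for i
      proof (cases "Suc i = c n")
        case True
        then have "\<not> hit i (b i) x" for x using c(1)[of n] unfolding hit_def by metis
        then show ?thesis using m_ge[of "c n"] i by (simp add: a_def h_def)
      next
        case False
        then have "m (Suc (Suc i)) \<le> m (c n)" using i strict_mono_less_eq[OF m_mono] by simp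
        then show ?thesis using a_less[of i] by simp
      qed
      then show ?thesis unfolding \<Sigma>_def b using m_ge[of "c n"] by auto
    qed
    obtain s2 A2 where sA: "q2 = (s2, A2)" by (cases q2)
    then have fin: "finite s2" and A2: "eventually (\<lambda>n. n \<in> A2) F" using q2(1) by auto
    obtain l where l: "\<forall>x\<in>s2. x < l" using fin by (metis finite_nat_set_iff_bounded)
    \<comment> \<open>Only finitely many \<open>n\<close> have \<open>c n < l\<close>; for the
      others, a move in the window of round \<open>c n\<close> lies above the stem
      \<open>s2\<close>.\<close>
    have "finite (c -` {..<l})" by (rule finite_vimageI[OF _ c(2)]) simp
    then obtain N where N: "\<forall>n\<in>c -` {..<l}. n < N" by (metis finite_nat_set_iff_bounded)
    have in2: "(s2, A2 \<inter> A) \<in> ?P" using fin A2 A(1) by (simp add: eventually_conj_iff)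
    have le2: "mathias_le (s2, A2 \<inter> A) q2" using fin by (simp add: sA initial_segment_refl)
    from g[OF in2 le2, of N] obtain n r' u where n: "N \<le> n" and r': "mathias_le r' (s2, A2 \<inter> A)"
      and u: "initial_segment u (fst r')" "\<psi>2 u n (g n)" by blast
    have uU: "u = U n" and good: "good (U n) (c n)" using u(2) c(3)[of n] by (auto simp: \<psi>2_def U_def)
    obtain x where "x \<in> U n \<inter> D (b (c n)) \<inter> {m (c n)..<m (Suc (Suc (c n)))}"
      using good b_\<Sigma> unfolding good_def by blast
    then have "hit (c n) (b (c n)) x" unfolding hit_def by blast
    then have "hit (c n) (b (c n)) (a (c n))" unfolding a_def by (rule h_hit)
    \<comment> \<open>As \<open>c\<close> is injective, round \<open>c n\<close> is served by
      \<open>U n\<close> alone, so the move belongs to the stem guessed at \<open>n\<close>.\<close>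
    then have a: "a (c n) \<in> U n" "a (c n) \<in> D (b (c n))" "m (c n) \<le> a (c n)"
      unfolding hit_def using inj_eq[OF c(2)] by auto
    have "a (c n) \<in> fst r'" using a(1) uU initial_segment_subset[OF u(1)] by blast
    moreover have "fst r' - s2 \<subseteq> A" using r' by (cases r') auto
    ultimately have "a (c n) \<in> s2" using A(2)[OF a(2)] by blast
    then have "c n < l" using l a(3) m_ge[of "c n"] by fastforce
    then have "n < N" using N by simp
    then show False using n by simp
  qed
qed

theorem corollary22:
  fixes F :: "nat filter"
  assumes "F \<noteq> bot" and "F \<le> cofinite"
    and "borel_filter F"
    and "\<not> adds_eventually_different_real (mathias_conditions F) mathias_le"
  shows "forcing_equivalent (mathias_conditions F) mathias_le cohen_conditions cohen_le"
proof (rule countably_generated_equivalent_cohen[OF assms(1,2)], rule ccontr)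
  assume ncg: "\<not> countably_generated F"
  have an: "analytic_set {x. eventually x F}"
    using assms(3) unfolding borel_filter_def by (rule borel_imp_analytic_set)
  show False
  proof (rule analytic_filter_strategy[OF an ncg])
    fix D :: "nat list \<Rightarrow> nat set"
    assume D: "\<And>\<sigma> A. eventually (\<lambda>n. n \<in> A) F \<Longrightarrow> A \<inter> D \<sigma> \<noteq> {}"
      "\<And>a. \<exists>A. eventually (\<lambda>n. n \<in> A) F \<and> (\<forall>n. a n \<in> D (map a [0..<n]) \<longrightarrow> a n \<notin> A)"
    from strategy_imp_adds_eventually_different_real[OF assms(2) D] assms(4) show False
      by (rule notE[rotated])
  qed
qed

end
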